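(* Let $\hat H$ be the generator of the truncated queueing-inventory process described in the context (truncation level $M\ge 1$), and let $\phi$ be the stationary probability vector of the generator $\mathbb{H}_M=\mathbb{H}_{M0}+\mathbb{H}_{M1}+\mathbb{H}_0$ on the finite phase set $E$, i.e. $\phi\,\mathbb{H}_M=\mathbf 0$ and $\phi\,\mathbf e=1$. Put $$z_1=\sum_{(\iota_2,\iota_3,\iota_4,\iota_5,\iota_6)\in E,\ \iota_6=N}\phi^{(\iota_2,\iota_3,\iota_4,\iota_5,\iota_6)},\qquad z_2=\sum_{(\iota_2,\iota_3,\iota_4,\iota_5,\iota_6)\in E,\ \iota_6\le N-1}\phi^{(\iota_2,\iota_3,\iota_4,\iota_5,\iota_6)} .$$ Then the stability condition for $\hat H$ is $$z_1\,p\lambda<z_2\,M\theta ,$$ that is, the continuous-time Markov chain with generator $\hat H$ has a (steady-state) stationary probability vector if and only if this inequality holds.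
   Context: Model. Integers $c\ge 1$ (number of identical servers), $N$ (waiting hall size, customers in service included), $S$ (maximal inventory), $s$ (reorder level), $Q=S-s$, with $c\le N$ and $c\le s<Q$. Real parameters $\lambda,\theta,\mu,\beta,\eta>0$ and $0<p\le 1$. $\mathbf e$ is a column vector of ones. Phase set. $E$ is the set of tuples $(\iota_2,\iota_3,\iota_4,\iota_5,\iota_6)$ of nonnegative integers ($\iota_2$ = inventory level, $\iota_3$ = servers on vacation, $\iota_4$ = busy servers, $\iota_5$ = idle servers, $\iota_6$ = customers in the waiting hall) such that, with $n=c-\iota_3$ the number of servers not on vacation: $0\le\iota_2\le S$, $0\le n\le c$, $0\le \iota_6\le N$, $\iota_4=\min(n,\iota_2,\iota_6)$, $\iota_5=n-\iota_4$, and either $n\ge1$ and $n\le\max(\iota_2,\iota_6)$, or $n=0$ and $\iota_2\in\{0,Q\}$. The phases with $n=0$ and $\iota_2=0$ (resp. $\iota_2=Q$) form the inventory class denoted $0^*$ (resp. $Q^*$). Since $\iota_4,\iota_5$ are determined by the rest, a phase is written $(\iota_2,n,\iota_6)$ below. Process. The state is $(\iota_1,\text{phase})$ with $\iota_1\in\{0,1,2,\dots\}$ the number of orbiting customers. From $(\iota_1;\iota_2,n,\iota_6)$ the transitions are: (1) primary arrival: if $\iota_6<N$, rate $\lambda$ to $(\iota_1;\iota_2,n,\iota_6+1)$; if $\iota_6=N$, rate $p\lambda$ to $(\iota_1+1;\iota_2,n,N)$ (with probability $1-p$ the customer is lost); (2) retrial: if $\iota_1\ge1$ and $\iota_6<N$,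 rate $\iota_1\theta$ to $(\iota_1-1;\iota_2,n,\iota_6+1)$; (3) service completion: if $\iota_4=\min(n,\iota_2,\iota_6)\ge1$, rate $\iota_4\mu$ to $(\iota_1;\iota_2-1,n',\iota_6-1)$, where $n'=n$ if $n\le\max(\iota_2-1,\iota_6-1)$ and $n'=n-1$ otherwise (a server starts a vacation); (4) replenishment: if $\iota_2\le s$, rate $\beta$ to $(\iota_1;\iota_2+Q,n,\iota_6)$; (5) vacation completion: if $n<c$ and $n+1\le\max(\iota_2,\iota_6)$, rate $\eta$ to $(\iota_1;\iota_2,n+1,\iota_6)$ (otherwise a returning server takes another vacation). Blocks. Ordering states by $\iota_1$, the generator is block tridiagonal: $\mathbb{H}_0$ is the $E\times E$ matrix of rates from orbit level $\iota_1$ to $\iota_1+1$, $\mathbb{H}_{\iota_1 0}$ that from $\iota_1$ to $\iota_1-1$ ($\iota_1\ge1$), and $\mathbb{H}_{\iota_1 1}$ that within level $\iota_1$, including the diagonal entries that make all row sums of the generator zero. Truncated generator. For $M\ge1$, $\hat H$ is the generator obtained by replacing $\mathbb{H}_{\iota_1 0}$ by $\mathbb{H}_{M0}$ and $\mathbb{H}_{\iota_1 1}$ by $\mathbb{H}_{M1}$ for all $\iota_1\ge M$ (the total retrial rate is $M\theta$ at all orbit levels $\ge M$). *)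

theory Defs
  imports "HOL-Analysis.Analysis"
begin

text \<open>
  A generator on a countable set \<open>A\<close> is a function \<open>G\<close>, with \<open>G x y\<close> the rate from \<open>x\<close> to \<open>y\<close>.
  Vectors are row vectors, so the balance equation is \<open>v G = 0\<close>, column by column.
\<close>

definition stationary_prob_vector :: "'a set \<Rightarrow> ('a \<Rightarrow> 'a \<Rightarrow> real) \<Rightarrow> ('a \<Rightarrow> real) \<Rightarrow> bool" where
  "stationary_prob_vector A G v \<longleftrightarrow>
     (\<forall>x\<in>A. 0 \<le> v x) \<and> (v has_sum 1) A \<and>
     (\<forall>y\<in>A. ((\<lambda>x. v x * G x y) has_sum 0) A)"

text \<open>
  A phase is \<open>(i2, i3, i4, i5, i6)\<close>: inventory level, servers on vacation, busy servers,
  idle servers, customers in the waiting hall.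
\<close>

type_synonym phase = "nat \<times> nat \<times> nat \<times> nat \<times> nat"

text \<open>
  \<open>c\<close> servers, hall size \<open>N\<close>, maximal inventory \<open>S\<close>, reorder level \<open>s\<close>; rates of primary
  arrival (\<open>lam\<close>), retrial per orbiting customer (\<open>\<theta>\<close>), service (\<open>\<mu>\<close>), replenishment (\<open>\<beta>\<close>) and
  vacation completion (\<open>\<eta>\<close>); \<open>p\<close> is the probability that a customer finding the hall full
  joins the orbit.
\<close>

locale queue_inventory =
  fixes c N S s :: nat
    and lam \<theta> \<mu> \<beta> \<eta> p :: real
begin

abbreviation Q :: nat where
  "Q \<equiv> S - s"

definition phases :: "phase set" where
  "phases = {(i2, i3, i4, i5, i6).
     i2 \<le> S \<and> i3 \<le> c \<and> i6 \<le> N \<and>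
     i4 = min (c - i3) (min i2 i6) \<and> i5 = (c - i3) - i4 \<and>
     (1 \<le> c - i3 \<and> c - i3 \<le> max i2 i6 \<or> c - i3 = 0 \<and> i2 \<in> {0, Q})}"

text \<open>The phase with inventory \<open>i2\<close>, \<open>n\<close> servers not on vacation and \<open>i6\<close> customers in the hall.\<close>

definition mk_phase :: "nat \<Rightarrow> nat \<Rightarrow> nat \<Rightarrow> phase" where
  "mk_phase i2 n i6 = (i2, c - n, min n (min i2 i6), n - min n (min i2 i6), i6)"

text \<open>
  Transition rates of the original process between states \<open>(orbit size, phase)\<close>. The summands
  are primary arrival (hall not full, hall full), retrial, service completion, replenishment
  and vacation completion.
\<close>

fun rate :: "nat \<times> phase \<Rightarrow> nat \<times> phase \<Rightarrow> real" where
  "rate (i1, (i2, i3, i4, i5, i6)) t =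
     (let n = c - i3;
          n' = (if n \<le> max (i2 - 1) (i6 - 1) then n else n - 1)
      in (if i6 < N \<and> t = (i1, mk_phase i2 n (i6 + 1)) then lam else 0)
       + (if i6 = N \<and> t = (i1 + 1, mk_phase i2 n N) then p * lam else 0)
       + (if 1 \<le> i1 \<and> i6 < N \<and> t = (i1 - 1, mk_phase i2 n (i6 + 1)) then real i1 * \<theta> else 0)
       + (if 1 \<le> i4 \<and> t = (i1, mk_phase (i2 - 1) n' (i6 - 1)) then real i4 * \<mu> else 0)
       + (if i2 \<le> s \<and> t = (i1, mk_phase (i2 + Q) n i6) then \<beta> else 0)
       + (if n < c \<and> n + 1 \<le> max i2 i6 \<and> t = (i1, mk_phase i2 (n + 1) i6) then \<eta> else 0))"

text \<open>
  The blocks of the generator: one orbit level up (the rates do not depend on the level, so they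
  are read off at level 0), one level down from \<open>i1 \<ge> 1\<close>, and within level \<open>i1\<close>. Every transition
  changes the orbit level by at most one, so the row sum for the diagonal only ranges over
  neighbouring levels; for \<open>i1 = 0\<close> these are \<open>0\<close> and \<open>1\<close>.
\<close>

definition H_up :: "phase \<Rightarrow> phase \<Rightarrow> real" where
  "H_up x y = rate (0, x) (1, y)"

definition H_down :: "nat \<Rightarrow> phase \<Rightarrow> phase \<Rightarrow> real" where
  "H_down i1 x y = rate (i1, x) (i1 - 1, y)"

definition H_within :: "nat \<Rightarrow> phase \<Rightarrow> phase \<Rightarrow> real" where
  "H_within i1 x y =
     rate (i1, x) (i1, y)
       - (if x = y then \<Sum>t \<in> {i1 - 1..i1 + 1} \<times> phases. rate (i1, x) t else 0)"

text \<open>The generator \<open>H_M\<close> on the phase set.\<close>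

definition phase_generator :: "nat \<Rightarrow> phase \<Rightarrow> phase \<Rightarrow> real" where
  "phase_generator M x y = H_down M x y + H_within M x y + H_up x y"

definition states :: "(nat \<times> phase) set" where
  "states = UNIV \<times> phases"

text \<open>The blocks of level \<open>i1\<close> are replaced by those of level \<open>M\<close> exactly when \<open>i1 \<ge> M\<close>.\<close>

fun truncated_generator :: "nat \<Rightarrow> nat \<times> phase \<Rightarrow> nat \<times> phase \<Rightarrow> real" where
  "truncated_generator M (i1, x) (j1, y) =
     (if j1 = i1 + 1 then H_up x y
      else if j1 = i1 then H_within (min i1 M) x y
      else if i1 = j1 + 1 then H_down (min i1 M) x y
      else 0)"

end

end

theory Submission
  imports Defs
begin

text \<open>
  Let \<open>f\<close> be the one-step drift of the orbit level as a function of the phase. All phases reach the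
  phase with empty inventory, full hall and no server on vacation without the orbit changing, so by
  the maximum principle the Poisson equation \<open>f + H\<^sub>M g = \<delta>\<close> is solvable with a constant \<open>\<delta>\<close>;
  pairing it with \<open>\<phi>\<close> gives \<open>\<delta> = \<phi> f = z\<^sub>1 p \<lambda> - z\<^sub>2 M \<theta>\<close>. The function \<open>V = level + g\<close> then
  has constant drift \<open>\<delta>\<close> at all levels \<open>\<ge> M\<close>. If \<open>\<delta> \<ge> 0\<close>, a clamped version of \<open>V\<close> contradicts
  stationarity. If \<open>\<delta> < 0\<close>, then by Foster's criterion the Cesaro averages of the uniformized chain
  keep a positive mass on the levels below \<open>M\<close>, and a pointwise limit of them, normalised, is
  stationary.
\<close>

section \<open>Level-homogeneous block tridiagonal generators\<close>

text \<open>Gaussian elimination, by induction on the columns. Column \<open>z\<close> has a pivot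
  row \<open>x0\<close>, since otherwise the indicator of \<open>z\<close> would be a nonzero kernel
  vector; eliminating with it leaves a smaller square system that is again injective.\<close>

lemma injective_system_solvable:
  fixes A :: "'a \<Rightarrow> 'b \<Rightarrow> real"
  assumes "finite C" "finite R" "card R = card C"
    and "\<And>h. (\<And>x. x \<in> R \<Longrightarrow> (\<Sum>y\<in>C. A x y * h y) = 0) \<Longrightarrow> (\<forall>y\<in>C. h y = 0)"
  shows "\<exists>g. \<forall>x\<in>R. (\<Sum>y\<in>C. A x y * g y) = b x"
  using assms
proof (induction C arbitrary: R A b rule: finite_induct)
  case empty
  then show ?case by simp
next
  case (insert z C)
  have "\<exists>x0\<in>R. A x0 z \<noteq> 0"
  proof (rule ccontr)
    assume "\<not> ?thesis"
    then have "(\<Sum>y\<in>insert z C. A x y * (if y = z then 1 else 0)) = 0" if "x \<in> R" for x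
      using that by (auto intro!: sum.neutral)
    from insert.prems(3)[OF this] show False by simp
  qed
  then obtain x0 where x0: "x0 \<in> R" "A x0 z \<noteq> 0" by blast
  define R' where "R' = R - {x0}"
  define A' where "A' x y = A x y - A x z * A x0 y / A x0 z" for x y
  define b' where "b' x = b x - A x z * b x0 / A x0 z" for x
  have A'_sum: "(\<Sum>y\<in>C. A' x y * h y)
      = (\<Sum>y\<in>C. A x y * h y) - A x z / A x0 z * (\<Sum>y\<in>C. A x0 y * h y)" for x h
    by (simp add: A'_def algebra_simps sum_subtractf sum_distrib_left)
  have extend: "(\<Sum>y\<in>insert z C. A x y * (h(z := a)) y) = A x z * a + (\<Sum>y\<in>C. A x y * h y)"
    for x h a
    using insert.hyps by (auto intro!: sum.cong)
  have "\<exists>g. \<forall>x\<in>R'. (\<Sum>y\<in>C. A' x y * g y) = b' x"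
  proof (rule insert.IH)
    show "finite R'" "card R' = card C"
      using insert.prems insert.hyps x0 by (auto simp: R'_def)
    show "\<forall>y\<in>C. h y = 0" if h: "\<And>x. x \<in> R' \<Longrightarrow> (\<Sum>y\<in>C. A' x y * h y) = 0" for h
    proof -
      \<comment> \<open>Back substitution: this value at \<open>z\<close> makes row
        \<open>x0\<close> vanish, so a kernel vector of the reduced system extends to one of the
        full system.\<close>
      define a where "a = - (\<Sum>y\<in>C. A x0 y * h y) / A x0 z"
      have "(\<Sum>y\<in>insert z C. A x y * (h(z := a)) y) = 0" if "x \<in> R" for x
      proof (cases "x = x0")
        case True
        then show ?thesis unfolding extend using x0 by (simp add: a_def)
      next
        case False
        then show ?thesis unfolding extend using h[of x] that x0(2)
          by (simp add: A'_sum R'_def a_def)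
      qed
      from insert.prems(3)[OF this] have "\<forall>y\<in>C. (h(z := a)) y = 0" by blast
      then show ?thesis using insert.hyps(2) by (metis fun_upd_other)
    qed
  qed
  then obtain g where g: "\<And>x. x \<in> R' \<Longrightarrow> (\<Sum>y\<in>C. A' x y * g y) = b' x" by blast
  define a where "a = (b x0 - (\<Sum>y\<in>C. A x0 y * g y)) / A x0 z"
  have "(\<Sum>y\<in>insert z C. A x y * (g(z := a)) y) = b x" if "x \<in> R" for x
  proof (cases "x = x0")
    case True
    then show ?thesis unfolding extend using x0 by (simp add: a_def)
  next
    case False
    then have "(\<Sum>y\<in>C. A x y * g y) - A x z / A x0 z * (\<Sum>y\<in>C. A x0 y * g y)
        = b x - A x z * b x0 / A x0 z"
      using g[of x] that by (simp add: A'_sum b'_def R'_def)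
    then show ?thesis unfolding extend a_def by (simp add: diff_divide_distrib algebra_simps)
  qed
  then show ?case by blast
qed

text \<open>Tychonoff in place of a diagonal argument. Countability of the index type makes the
  function space first countable, so that compactness yields convergent subsequences.\<close>

lemma bounded_pointwise_convergent_subseq:
  fixes a :: "nat \<Rightarrow> 'b::countable \<Rightarrow> real"
  assumes "\<And>n y. a n y \<in> {0..1}"
  shows "\<exists>v \<rho>. strict_mono (\<rho> :: nat \<Rightarrow> nat) \<and> (\<forall>y. (\<lambda>k. a (\<rho> k) y) \<longlonglongrightarrow> v y)"
proof -
  have "compactin (product_topology (\<lambda>_::'b. euclidean) UNIV) (PiE UNIV (\<lambda>_. {0..1::real}))"
    by (simp add: compactin_PiE)
  then have "seq_compact (PiE UNIV (\<lambda>_::'b. {0..1::real}))"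
    by (intro compact_imp_seq_compact) (simp add: euclidean_product_topology)
  moreover have "\<forall>n. a n \<in> PiE UNIV (\<lambda>_. {0..1})" using assms by auto
  ultimately obtain v \<rho> where \<rho>: "strict_mono (\<rho> :: nat \<Rightarrow> nat)" "(a \<circ> \<rho>) \<longlonglongrightarrow> v"
    unfolding seq_compact_def by metis
  have "(\<lambda>k. a (\<rho> k) y) \<longlonglongrightarrow> v y" for y
    using continuous_on_tendsto_compose[OF continuous_on_product_coordinates \<rho>(2), of y]
    by simp
  with \<rho>(1) show ?thesis by blast
qed

text \<open>A quasi-birth-death process with blocks \<open>U\<close> (up), \<open>W i\<close>
  (within) and \<open>D i\<close> (down). Reachability of \<open>r\<close> is phrased through closed
  sets instead of paths: both the maximizers of a function and the support of a stationary vector on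
  one level turn out to be such sets.\<close>

locale level_process =
  fixes E :: "'a::countable set"
    and U :: "'a \<Rightarrow> 'a \<Rightarrow> real"
    and W D :: "nat \<Rightarrow> 'a \<Rightarrow> 'a \<Rightarrow> real"
    and M :: nat
    and r :: 'a
  assumes finite_E: "finite E"
    and M_pos: "1 \<le> M"
    and U_nonneg: "\<And>x y. x \<in> E \<Longrightarrow> y \<in> E \<Longrightarrow> 0 \<le> U x y"
    and D_nonneg: "\<And>i x y. x \<in> E \<Longrightarrow> y \<in> E \<Longrightarrow> 0 \<le> D i x y"
    and W_nonneg: "\<And>i x y. x \<in> E \<Longrightarrow> y \<in> E \<Longrightarrow> x \<noteq> y \<Longrightarrow> 0 \<le> W i x y"
    and row_sum_0: "\<And>x. x \<in> E \<Longrightarrow> (\<Sum>y\<in>E. W 0 x y + U x y) = 0"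
    and row_sum: "\<And>i x. x \<in> E \<Longrightarrow> 1 \<le> i \<Longrightarrow> (\<Sum>y\<in>E. D i x y + W i x y + U x y) = 0"
    and reach: "\<And>i T. T \<subseteq> E \<Longrightarrow> T \<noteq> {} \<Longrightarrow>
      (\<And>x y. x \<in> T \<Longrightarrow> y \<in> E \<Longrightarrow> x \<noteq> y \<Longrightarrow> 0 < W i x y \<Longrightarrow> y \<in> T) \<Longrightarrow> r \<in> T"
    and r_in: "r \<in> E"
    and U_r: "0 < U r r"
begin

section \<open>Maximum principle and Poisson equation for the phase generator\<close>

definition H :: "'a \<Rightarrow> 'a \<Rightarrow> real" where
  "H x y = D M x y + W M x y + U x y"

lemma H_row_sum: "x \<in> E \<Longrightarrow> (\<Sum>y\<in>E. H x y) = 0"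
  unfolding H_def using row_sum[OF _ M_pos] .

lemma H_nonneg: "x \<in> E \<Longrightarrow> y \<in> E \<Longrightarrow> x \<noteq> y \<Longrightarrow> 0 \<le> H x y"
  unfolding H_def using U_nonneg[of x y] D_nonneg[of x y M] W_nonneg[of x y M] by simp

text \<open>Maximum principle. At a maximizer \<open>x\<close> the zero row sum gives
  \<open>0 \<le> - (\<Sum>y\<in>E. H x y * (m - h y))\<close> with nonnegative summands, so all of
  them vanish and every \<open>y\<close> with \<open>0 < W M x y\<close> is a maximizer too. The set
  of maximizers is thus closed and contains \<open>r\<close>.\<close>

lemma subharmonic_le:
  assumes sub: "\<And>x. x \<in> E \<Longrightarrow> 0 \<le> (\<Sum>y\<in>E. H x y * h y)"
  shows "\<And>x. x \<in> E \<Longrightarrow> h x \<le> h r" and "(\<Sum>y\<in>E. H r y * h y) = 0"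
proof -
  define m where "m = Max (h ` E)"
  have le: "h x \<le> m" if "x \<in> E" for x
    unfolding m_def using finite_E that by simp
  define T where "T = {x\<in>E. h x = m}"
  have "m \<in> h ` E" unfolding m_def using finite_E r_in by (intro Max_in) auto
  then have T_ne: "T \<noteq> {}" unfolding T_def by auto
  have shift: "(\<Sum>y\<in>E. H x y * h y) = - (\<Sum>y\<in>E. H x y * (m - h y))" if "x \<in> E" for x
    using H_row_sum[OF that]
    by (simp add: right_diff_distrib sum_subtractf flip: sum_distrib_right)
  have nonneg: "0 \<le> H x y * (m - h y)" if "x \<in> T" "y \<in> E" for x y
    using that H_nonneg[of x y] le[of y] by (cases "x = y") (auto simp: T_def)
  have zero: "(\<Sum>y\<in>E. H x y * (m - h y)) = 0" if "x \<in> T" for x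
    using sub[of x] shift[of x] sum_nonneg[of E "\<lambda>y. H x y * (m - h y)"] nonneg[OF that] that
    by (force simp: T_def)
  have "r \<in> T"
  proof (rule reach)
    show "T \<subseteq> E" "T \<noteq> {}" using T_ne by (auto simp: T_def)
    fix x y assume xy: "x \<in> T" "y \<in> E" "x \<noteq> y" "0 < W M x y"
    then have "H x y * (m - h y) = 0"
      using zero[of x] nonneg[of x] finite_E by (simp add: sum_nonneg_eq_0_iff)
    moreover have "0 < H x y"
      unfolding H_def using xy U_nonneg[of x y] D_nonneg[of x y M] by (auto simp: T_def)
    ultimately show "y \<in> T" using xy by (auto simp: T_def)
  qed
  then show "h x \<le> h r" if "x \<in> E" for x using le[OF that] by (simp add: T_def)
  show "(\<Sum>y\<in>E. H r y * h y) = 0" using zero[OF \<open>r \<in> T\<close>] shift[OF r_in] by simp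
qed

text \<open>The maximum principle applies to \<open>h\<close> if \<open>0 \<le> d\<close> and to
  \<open>- h\<close> otherwise, which forces \<open>d = 0\<close>; then it applies to both, so
  \<open>h\<close> is largest and smallest at \<open>r\<close>.\<close>

lemma harmonic_up_to_constant:
  assumes H: "\<And>x. x \<in> E \<Longrightarrow> (\<Sum>y\<in>E. H x y * h y) = d"
  shows "d = 0" and "\<And>x. x \<in> E \<Longrightarrow> h x = h r"
proof -
  have neg: "(\<Sum>y\<in>E. H x y * (- h y)) = - d" if "x \<in> E" for x
    using H[OF that] by (simp add: sum_negf)
  show d: "d = 0"
  proof (cases "0 \<le> d")
    case True
    then show ?thesis using subharmonic_le(2)[of h] H r_in by simp
  next
    case False
    then show ?thesis using subharmonic_le(2)[of "\<lambda>x. - h x"] neg r_in by simp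
  qed
  show "h x = h r" if "x \<in> E" for x
    using subharmonic_le(1)[of h x] subharmonic_le(1)[of "\<lambda>x. - h x" x] H neg d that by simp
qed

text \<open>The unknown \<open>g r\<close> is normalised to \<open>0\<close>; its column is reused for the unknown \<open>\<delta>\<close>.\<close>

lemma poisson_equation: "\<exists>g \<delta>. \<forall>x\<in>E. f x + (\<Sum>y\<in>E. H x y * g y) = (\<delta>::real)"
proof -
  define B where "B x y = (if y = r then -1 else H x y)" for x y
  have B_sum: "(\<Sum>y\<in>E. B x y * h y) = (\<Sum>y\<in>E. H x y * (h(r := 0)) y) - h r" for x h
    using finite_E r_in by (simp add: B_def sum.remove[of _ r])
  have "\<exists>g. \<forall>x\<in>E. (\<Sum>y\<in>E. B x y * g y) = - f x"
  proof (rule injective_system_solvable)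
    fix h assume h: "\<And>x. x \<in> E \<Longrightarrow> (\<Sum>y\<in>E. B x y * h y) = 0"
    then have "\<And>x. x \<in> E \<Longrightarrow> (\<Sum>y\<in>E. H x y * (h(r := 0)) y) = h r"
      by (simp add: B_sum)
    \<comment> \<open>The constant is zero, so \<open>h r = 0\<close>; and \<open>h(r := 0)\<close>
      is constant with value 0 at \<open>r\<close>, so \<open>h\<close> vanishes.\<close>
    from harmonic_up_to_constant[OF this] show "\<forall>y\<in>E. h y = 0"
      by (metis fun_upd_apply)
  qed (use finite_E in auto)
  then obtain g where "\<And>x. x \<in> E \<Longrightarrow> (\<Sum>y\<in>E. B x y * g y) = - f x" by blast
  then have "\<forall>x\<in>E. f x + (\<Sum>y\<in>E. H x y * (g(r := 0)) y) = g r"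
    unfolding B_sum by (simp add: diff_eq_eq)
  then show ?thesis by blast
qed

section \<open>Mean drift under the stationary phase vector\<close>

definition drift :: "'a \<Rightarrow> real" where
  "drift x = (\<Sum>y\<in>E. U x y) - (\<Sum>y\<in>E. D M x y)"

lemma mean_drift:
  assumes \<phi>: "stationary_prob_vector E H \<phi>"
    and g: "\<And>x. x \<in> E \<Longrightarrow> drift x + (\<Sum>y\<in>E. H x y * g y) = \<delta>"
  shows "(\<Sum>x\<in>E. \<phi> x * drift x) = \<delta>"
proof -
  have one: "(\<Sum>x\<in>E. \<phi> x) = 1"
    using \<phi> finite_E unfolding stationary_prob_vector_def
    by (meson has_sum_finite has_sum_unique)
  have col: "(\<Sum>x\<in>E. \<phi> x * H x y) = 0" if "y \<in> E" for y
    using \<phi> finite_E that unfolding stationary_prob_vector_def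
    by (meson has_sum_finite has_sum_unique)
  have "(\<Sum>x\<in>E. \<phi> x * (\<Sum>y\<in>E. H x y * g y)) = (\<Sum>x\<in>E. \<Sum>y\<in>E. \<phi> x * H x y * g y)"
    by (simp add: sum_distrib_left mult.assoc)
  also have "\<dots> = (\<Sum>y\<in>E. (\<Sum>x\<in>E. \<phi> x * H x y) * g y)"
    by (subst sum.swap) (simp add: sum_distrib_right)
  also have "\<dots> = 0" by (simp add: col)
  finally have "(\<Sum>x\<in>E. \<phi> x * drift x)
      = (\<Sum>x\<in>E. \<phi> x * (drift x + (\<Sum>y\<in>E. H x y * g y)))"
    by (simp add: distrib_left sum.distrib)
  also have "\<dots> = \<delta>" using one by (simp add: g flip: sum_distrib_right)
  finally show ?thesis .
qed

section \<open>The chain on levels and phases, and its action on functions\<close>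

definition S :: "(nat \<times> 'a) set" where "S = UNIV \<times> E"

fun G :: "nat \<times> 'a \<Rightarrow> nat \<times> 'a \<Rightarrow> real" where
  "G (i, x) (j, y) =
     (if j = i + 1 then U x y
      else if j = i then W (min i M) x y
      else if i = j + 1 then D (min i M) x y
      else 0)"

text \<open>Truncated subtraction turns the levels into 0 and 1 when \<open>z\<close> has level 0.
  The relation is symmetric on \<open>S\<close>, so the same finite set supports the row and the
  column of \<open>G\<close> at \<open>z\<close>.\<close>

definition nbr :: "nat \<times> 'a \<Rightarrow> (nat \<times> 'a) set" where
  "nbr z = {fst z - 1..fst z + 1} \<times> E"

lemma finite_nbr: "finite (nbr z)"
  by (simp add: nbr_def finite_E)

lemma nbr_subset: "nbr z \<subseteq> S"
  by (auto simp: nbr_def S_def)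

lemma self_in_nbr: "z \<in> S \<Longrightarrow> z \<in> nbr z"
  by (auto simp: nbr_def S_def)

lemma nbr_sym: "z \<in> S \<Longrightarrow> w \<in> S \<Longrightarrow> w \<in> nbr z \<longleftrightarrow> z \<in> nbr w"
  by (auto simp: nbr_def S_def)

lemma G_eq_0: "z \<in> S \<Longrightarrow> w \<in> S \<Longrightarrow> w \<notin> nbr z \<Longrightarrow> G z w = 0"
  by (cases z; cases w) (auto simp: nbr_def S_def)

lemma G_nonneg: "z \<in> S \<Longrightarrow> w \<in> S \<Longrightarrow> z \<noteq> w \<Longrightarrow> 0 \<le> G z w"
  by (cases z; cases w) (auto simp: S_def U_nonneg D_nonneg W_nonneg)

text \<open>Only finitely many values occur, because the blocks repeat from level \<open>M\<close>
  on. The bound later serves as uniformization constant.\<close>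

lemma G_bounded: "\<exists>K>0. \<forall>z\<in>S. \<forall>w\<in>S. \<bar>G z w\<bar> \<le> K"
proof -
  define V where "V = insert 0 ((\<lambda>(x, y). U x y) ` (E \<times> E)
     \<union> (\<lambda>(i, x, y). W i x y) ` ({..M} \<times> E \<times> E) \<union> (\<lambda>(i, x, y). D i x y) ` ({..M} \<times> E \<times> E))"
  have "finite V" unfolding V_def using finite_E by simp
  then obtain K where "K > 0" "\<forall>v\<in>V. norm v \<le> K"
    using finite_imp_bounded bounded_pos by metis
  moreover have "G z w \<in> V" if "z \<in> S" "w \<in> S" for z w
    using that unfolding V_def S_def
    by (cases z; cases w) (force simp: image_iff)
  ultimately show ?thesis by (metis real_norm_def)
qed

text \<open>The generator applied to a column vector. The sum over neighbours is finite, so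
  \<open>h\<close> may be unbounded.\<close>

definition Gop :: "(nat \<times> 'a \<Rightarrow> real) \<Rightarrow> nat \<times> 'a \<Rightarrow> real" where
  "Gop h z = (\<Sum>w\<in>nbr z. G z w * h w)"

lemma Gop_level_pos:
  assumes "1 \<le> i"
  shows "Gop h (i, x) = (\<Sum>y\<in>E. D (min i M) x y * h (i - 1, y) + W (min i M) x y * h (i, y)
    + U x y * h (i + 1, y))"
proof -
  have "{i - 1..i + 1} = {i - 1, i, i + 1}" using assms by auto
  then have "Gop h (i, x) = (\<Sum>j\<in>{i - 1, i, i + 1}. \<Sum>y\<in>E. G (i, x) (j, y) * h (j, y))"
    unfolding Gop_def nbr_def by (simp add: sum.cartesian_product del: G.simps)
  then show ?thesis using assms by (cases i) (simp_all add: sum.distrib)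
qed

lemma Gop_level_0: "Gop h (0, x) = (\<Sum>y\<in>E. W 0 x y * h (0, y) + U x y * h (1, y))"
proof -
  have "{0 - 1..0 + 1} = {0, 1::nat}" by auto
  then have "Gop h (0, x) = (\<Sum>j\<in>{0, 1}. \<Sum>y\<in>E. G (0, x) (j, y) * h (j, y))"
    unfolding Gop_def nbr_def by (simp add: sum.cartesian_product del: G.simps)
  then show ?thesis by (simp add: sum.distrib)
qed

lemma Gop_const: "z \<in> S \<Longrightarrow> Gop (\<lambda>_. a) z = 0"
proof (cases z)
  case (Pair i x)
  assume "z \<in> S"
  then have x: "x \<in> E" by (simp add: Pair S_def)
  show ?thesis
  proof (cases "i = 0")
    case True
    then show ?thesis using row_sum_0[OF x]
      by (simp add: Pair Gop_level_0 flip: distrib_right sum_distrib_right)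
  next
    case False
    then show ?thesis using row_sum[OF x, of "min i M"] M_pos
      by (simp add: Pair Gop_level_pos flip: distrib_right sum_distrib_right)
  qed
qed

lemma Gop_diff: "Gop (\<lambda>w. h w - k w) z = Gop h z - Gop k z"
  by (simp add: Gop_def right_diff_distrib sum_subtractf)

lemma Gop_centered: "z \<in> S \<Longrightarrow> Gop h z = (\<Sum>w\<in>nbr z. G z w * (h w - h z))"
  using Gop_const[of z "h z"] Gop_diff[of h "\<lambda>_. h z" z] by (simp add: Gop_def)

text \<open>Off-diagonal rates are nonnegative, and the diagonal term is the same on both sides
  since \<open>h\<close> and \<open>k\<close> agree at \<open>z\<close>.\<close>

lemma Gop_mono:
  assumes "z \<in> S" "h z = k z" "\<And>w. w \<in> nbr z \<Longrightarrow> h w \<le> k w"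
  shows "Gop h z \<le> Gop k z"
  unfolding Gop_def
proof (rule sum_mono)
  fix w assume w: "w \<in> nbr z"
  then show "G z w * h w \<le> G z w * k w"
    using assms(1,2) assms(3)[OF w] G_nonneg[of z w] nbr_subset[of z]
    by (cases "z = w") (auto intro!: mult_left_mono)
qed

text \<open>The contribution of the current level \<open>i\<close> cancels because the rows of
  \<open>H\<close> sum to zero. The level changes of one step leave \<open>drift x\<close>, and
  \<open>g\<close> adds the remaining term of the Poisson equation.\<close>

lemma Gop_lyapunov:
  assumes g: "\<And>x. x \<in> E \<Longrightarrow> drift x + (\<Sum>y\<in>E. H x y * g y) = \<delta>"
    and "(i, x) \<in> S" "M \<le> i"
  shows "Gop (\<lambda>w. real (fst w) + g (snd w)) (i, x) = \<delta>"
proof -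
  have x: "x \<in> E" and i: "1 \<le> i" "min i M = M" using assms M_pos by (auto simp: S_def)
  have "Gop (\<lambda>w. real (fst w) + g (snd w)) (i, x)
     = (\<Sum>y\<in>E. real i * H x y + (U x y - D M x y) + H x y * g y)"
    unfolding Gop_level_pos[OF i(1)] i(2)
    by (rule sum.cong) (use i in \<open>auto simp: H_def of_nat_diff algebra_simps\<close>)
  also have "\<dots> = \<delta>"
    using H_row_sum[OF x] g[OF x]
    by (simp add: drift_def sum.distrib sum_subtractf flip: sum_distrib_left)
  finally show ?thesis .
qed

subsection \<open>Nonnegative mean drift\<close>

text \<open>If \<open>\<pi> w = 0\<close>, the diagonal term of the balance equation at
  \<open>w\<close> disappears. The inflow terms are nonnegative with sum zero, so each is
  zero.\<close>

lemma stationary_pos_step: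
  assumes \<pi>: "stationary_prob_vector S G \<pi>"
    and zw: "z \<in> S" "w \<in> S" "z \<noteq> w" "0 < G z w" "0 < \<pi> z"
  shows "0 < \<pi> w"
proof (rule ccontr)
  assume "\<not> ?thesis"
  then have w0: "\<pi> w = 0"
    using \<pi> zw(2) unfolding stationary_prob_vector_def by (metis order_le_less)
  have "((\<lambda>x. \<pi> x * G x w) has_sum 0) S"
    using \<pi> zw(2) unfolding stationary_prob_vector_def by blast
  moreover have "0 \<le> \<pi> x * G x w" if "x \<in> S" for x
    using \<pi> that G_nonneg[OF that zw(2)] w0 unfolding stationary_prob_vector_def
    by (cases "x = w") auto
  ultimately have "\<pi> z * G z w = 0"
    using nonneg_has_sum_le_0D[of "\<lambda>x. \<pi> x * G x w" S 0 z] zw(1) by simp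
  with zw show False by simp
qed

text \<open>The phases charged on one level form a closed set and hence include \<open>r\<close>;
  from there \<open>U r r > 0\<close> carries the charge upwards. This provides a charged state high
  enough for the clamping argument below.\<close>

lemma stationary_pos_upwards:
  assumes \<pi>: "stationary_prob_vector S G \<pi>"
  shows "\<exists>i. \<forall>k\<ge>i. 0 < \<pi> (k, r)"
proof -
  have "\<exists>z\<in>S. 0 < \<pi> z"
  proof (rule ccontr)
    assume "\<not> ?thesis"
    then have "\<pi> z = 0" if "z \<in> S" for z
      using \<pi> that unfolding stationary_prob_vector_def by (metis order_le_less)
    then have "(\<pi> has_sum 0) S" by (rule has_sum_0)
    then show False
      using \<pi> has_sum_unique unfolding stationary_prob_vector_def by (metis zero_neq_one)
  qed
  then obtain i x where ix: "x \<in> E" "0 < \<pi> (i, x)" by (auto simp: S_def)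
  have "r \<in> {x\<in>E. 0 < \<pi> (i, x)}"
  proof (rule reach)
    show "{x\<in>E. 0 < \<pi> (i, x)} \<noteq> {}" using ix by blast
    fix x y assume *: "x \<in> {x\<in>E. 0 < \<pi> (i, x)}" "y \<in> E" "x \<noteq> y" "0 < W (min i M) x y"
    then show "y \<in> {x\<in>E. 0 < \<pi> (i, x)}"
      using stationary_pos_step[OF \<pi>, of "(i, x)" "(i, y)"] by (auto simp: S_def)
  qed auto
  then have "0 < \<pi> (i, r)" by simp
  have "0 < \<pi> (k, r)" if "i \<le> k" for k
    using that
  proof (induction rule: dec_induct)
    case (step k)
    then show ?case
      using stationary_pos_step[OF \<pi>, of "(k, r)" "(Suc k, r)"] r_in U_r by (auto simp: S_def)
  qed fact
  then show ?thesis by blast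
qed

text \<open>Only the finitely many columns in \<open>F\<close> enter, so the balance equations can
  be added up without exchanging two infinite sums.\<close>

lemma stationary_pairing:
  assumes \<pi>: "stationary_prob_vector S G \<pi>"
    and F: "finite F" "F \<subseteq> S" "\<And>w. w \<in> S - F \<Longrightarrow> h w = 0"
  shows "((\<lambda>z. \<pi> z * Gop h z) has_sum 0) S"
proof -
  have "((\<lambda>z. \<Sum>w\<in>F. \<pi> z * G z w * h w) has_sum (\<Sum>w\<in>F. 0 * h w)) S"
    using F(1,2)
  proof (induction F rule: finite_induct)
    case (insert w F)
    have "((\<lambda>z. \<pi> z * G z w) has_sum 0) S"
      using \<pi> insert.prems unfolding stationary_prob_vector_def by blast
    from has_sum_add[OF has_sum_cmult_left[OF this, of "h w"] insert.IH]
    show ?case using insert by simp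
  qed simp
  moreover have "(\<Sum>w\<in>F. \<pi> z * G z w * h w) = \<pi> z * Gop h z" if z: "z \<in> S" for z
  proof -
    have "(\<Sum>w\<in>F. G z w * h w) = (\<Sum>w\<in>nbr z. G z w * h w)"
    proof (rule sum.mono_neutral_cong)
      show "G z w * h w = 0" if "w \<in> nbr z - F" for w
        using F(3)[of w] that nbr_subset[of z] by auto
      show "G z w * h w = 0" if "w \<in> F - nbr z" for w
        using G_eq_0[OF z, of w] that F(2) by auto
    qed (use F finite_nbr in auto)
    then show ?thesis by (simp add: Gop_def mult.assoc flip: sum_distrib_left)
  qed
  ultimately show ?thesis using has_sum_cong[of S "\<lambda>z. \<Sum>w\<in>F. \<pi> z * G z w * h w"] by simp
qed

text \<open>There are at most \<open>3 * card E\<close> neighbours, and level plus \<open>g\<close>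
  changes by at most \<open>1 + 2 * B\<close> between them. The bound must be uniform in
  \<open>h\<close>: it is fixed before the clamped function to which it is applied.\<close>

lemma Gop_lipschitz_bound:
  assumes B: "0 \<le> B" "\<And>x. x \<in> E \<Longrightarrow> \<bar>g x\<bar> \<le> (B::real)"
  shows "\<exists>K>0. \<forall>z\<in>S. \<forall>h. (\<forall>w\<in>nbr z. \<bar>h w - h z\<bar> \<le>
    \<bar>(real (fst w) + g (snd w)) - (real (fst z) + g (snd z))\<bar>) \<longrightarrow> - K \<le> Gop h z"
proof -
  obtain K where K: "K > 0" "\<And>z w. z \<in> S \<Longrightarrow> w \<in> S \<Longrightarrow> \<bar>G z w\<bar> \<le> K"
    using G_bounded by blast
  define K' where "K' = real (3 * card E) * (K * (1 + 2 * B)) + 1"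
  have "- K' \<le> Gop h z" if z: "z \<in> S" and h: "\<forall>w\<in>nbr z. \<bar>h w - h z\<bar> \<le>
    \<bar>(real (fst w) + g (snd w)) - (real (fst z) + g (snd z))\<bar>" for z h
  proof -
    have "\<bar>G z w * (h w - h z)\<bar> \<le> K * (1 + 2 * B)" if w: "w \<in> nbr z" for w
    proof -
      have "\<bar>real (fst w) - real (fst z)\<bar> \<le> 1" using w by (auto simp: nbr_def)
      moreover have "\<bar>g (snd w)\<bar> \<le> B" "\<bar>g (snd z)\<bar> \<le> B"
        using w z B by (auto simp: nbr_def S_def)
      ultimately have "\<bar>h w - h z\<bar> \<le> 1 + 2 * B" using bspec[OF h w] by linarith
      moreover have "\<bar>G z w\<bar> \<le> K" using K(2)[OF z] w nbr_subset by blast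
      ultimately show ?thesis unfolding abs_mult using K(1) by (intro mult_mono) auto
    qed
    then have "\<bar>Gop h z\<bar> \<le> (\<Sum>w\<in>nbr z. K * (1 + 2 * B))"
      unfolding Gop_centered[OF z] by (intro order_trans[OF sum_abs] sum_mono)
    also have "\<dots> = real (card (nbr z)) * (K * (1 + 2 * B))" by simp
    also have "\<dots> \<le> real (3 * card E) * (K * (1 + 2 * B))"
    proof (intro mult_right_mono of_nat_mono)
      show "card (nbr z) \<le> 3 * card E" unfolding nbr_def card_cartesian_product by (intro mult_right_mono) auto
    qed (use K B in auto)
    finally show ?thesis unfolding K'_def by simp
  qed
  moreover have "K' > 0" unfolding K'_def using K B by (intro add_nonneg_pos) auto
  ultimately show ?thesis by blast
qed

text \<open>
  Pairing \<open>\<pi>\<close> with \<open>V = level + g\<close> is not possible, since \<open>V\<close> need not be \<open>\<pi>\<close>-integrable; \<open>V\<close> is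
  therefore clamped between two levels. The lower clamp keeps it subharmonic and makes it
  strictly so at one state charged by \<open>\<pi>\<close>; the upper clamp costs a term proportional to the tail
  of \<open>\<pi>\<close>.
\<close>

lemma no_stationary:
  assumes g: "\<And>x. x \<in> E \<Longrightarrow> drift x + (\<Sum>y\<in>E. H x y * g y) = \<delta>"
    and \<delta>: "0 \<le> \<delta>"
    and \<pi>: "stationary_prob_vector S G \<pi>"
  shows False
proof -
  have \<pi>0: "\<And>z. z \<in> S \<Longrightarrow> 0 \<le> \<pi> z" and \<pi>1: "(\<pi> has_sum 1) S"
    using \<pi> unfolding stationary_prob_vector_def by auto
  define V where "V w = real (fst w) + g (snd w)" for w :: "nat \<times> 'a"
  define B where "B = (\<Sum>x\<in>E. \<bar>g x\<bar>)"
  have B: "0 \<le> B" "\<And>x. x \<in> E \<Longrightarrow> \<bar>g x\<bar> \<le> B"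
    unfolding B_def using finite_E by (auto intro: sum_nonneg member_le_sum)
  have V: "real (fst w) - B \<le> V w" "V w \<le> real (fst w) + B" if "w \<in> S" for w
    using B(2)[of "snd w"] that by (auto simp: V_def S_def abs_le_iff)
  obtain K where K: "K > 0" "\<And>z h. z \<in> S \<Longrightarrow> (\<And>w. w \<in> nbr z \<Longrightarrow> \<bar>h w - h z\<bar> \<le> \<bar>V w - V z\<bar>)
      \<Longrightarrow> - K \<le> Gop h z"
    using Gop_lipschitz_bound[of B g] B unfolding V_def by blast
  obtain i0 where i0: "\<And>k. i0 \<le> k \<Longrightarrow> 0 < \<pi> (k, r)"
    using stationary_pos_upwards[OF \<pi>] by blast
  \<comment> \<open>So large that \<open>C = V (k, r)\<close> is at least \<open>M + B\<close>: then
    \<open>V z > C\<close> forces level at least \<open>M\<close>, where \<open>V\<close> has drift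
    \<open>\<delta>\<close>.\<close>
  define k where "k = max i0 (nat \<lceil>real M + 2 * B\<rceil>)"
  have k: "0 < \<pi> (k, r)" "real M + 2 * B \<le> real k"
    using i0[of k] unfolding k_def by (simp, linarith)
  define C where "C = V (k, r)"
  have kS: "(k, r) \<in> S" "(k + 1, r) \<in> S" using r_in by (auto simp: S_def)
  have C: "real M + B \<le> C" using V(1)[OF kS(1)] k(2) by (simp add: C_def)
  \<comment> \<open>The gain at \<open>(k, r)\<close>: the clamped function \<open>h\<close> below
    is 0 there and 1 at \<open>(k + 1, r)\<close>, reached at rate \<open>U r r\<close>. The set
    \<open>F0\<close> omits so little mass that the loss outside it, at most \<open>K\<close> per
    unit of mass, is at most half of this gain.\<close>
  define \<epsilon> where "\<epsilon> = \<pi> (k, r) * U r r"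
  have \<epsilon>: "\<epsilon> > 0" unfolding \<epsilon>_def using k U_r by simp
  obtain F0 where F0: "finite F0" "F0 \<subseteq> S" "dist (sum \<pi> F0) 1 \<le> \<epsilon> / (2 * K)"
    using has_sum_finite_approximation[OF \<pi>1, of "\<epsilon> / (2 * K)"] \<epsilon> K by auto
  \<comment> \<open>Above \<open>k + 1\<close> and all levels of \<open>F0\<close>. With
    \<open>T = l + B\<close> the upper clamp is inactive at all neighbours of states below level
    \<open>l\<close>.\<close>
  define l where "l = Suc (Max (insert (k + 1) (fst ` F0)))"
  have l: "k + 1 < l" "\<And>z. z \<in> F0 \<Longrightarrow> fst z < l"
    unfolding l_def using F0(1) by (auto simp: less_Suc_eq_le)
  define T where "T = real l + B"
  have "V (k + 1, r) = C + 1" by (simp add: C_def V_def)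
  then have T: "C + 1 \<le> T" using V(2)[OF kS(2)] l(1) by (simp add: T_def)
  define h where "h w = min (T - C) (max 0 (V w - C))" for w
  have h0: "0 \<le> h w" for w using T by (simp add: h_def)

  \<comment> \<open>If \<open>V z \<le> C\<close>, then \<open>h\<close> attains its minimum 0 at
    \<open>z\<close>. Otherwise \<open>z\<close> has level at least \<open>M\<close>, and on its
    neighbours \<open>h\<close> dominates \<open>V - C\<close>, with equality at
    \<open>z\<close>.\<close>
  have Gop_h_ge: "0 \<le> Gop h z" if z: "z \<in> S" "fst z < l" for z
  proof (cases "V z \<le> C")
    case True
    then have "h z = 0" using T by (simp add: h_def)
    then show ?thesis using Gop_mono[of z "\<lambda>_. 0" h] Gop_const[of z 0] z h0 by simp
  next
    case False
    have "M \<le> fst z" using False V(2)[OF z(1)] C by linarith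
    have le_T: "V w \<le> T" if "w \<in> nbr z" for w
    proof -
      have "fst w \<le> l" "w \<in> S" using that z(2) nbr_subset[of z] by (auto simp: nbr_def S_def)
      then show ?thesis using V(2)[of w] by (simp add: T_def)
    qed
    have "\<delta> = Gop V z"
      using Gop_lyapunov[OF g, of "fst z" "snd z"] z(1) \<open>M \<le> fst z\<close> by (simp add: V_def[abs_def])
    also have "\<dots> = Gop (\<lambda>w. V w - C) z" using Gop_diff[of V "\<lambda>_. C" z] Gop_const z(1) by simp
    also have "\<dots> \<le> Gop h z"
      using False le_T[OF self_in_nbr[OF z(1)]] le_T
      by (intro Gop_mono z(1)) (auto simp: h_def)
    finally show ?thesis using \<delta> by simp
  qed

  have Gop_h_ge': "- K \<le> Gop h z" if "z \<in> S" for z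
    by (rule K(2)[OF that]) (auto simp: h_def)

  have Gop_h_k: "U r r \<le> Gop h (k, r)"
  proof -
    have "h (k, r) = 0" "h (k + 1, r) = 1" using T by (auto simp: h_def C_def V_def)
    then have "U r r = G (k, r) (k + 1, r) * h (k + 1, r)" by simp
    also have "\<dots> \<le> Gop h (k, r)"
      unfolding Gop_def
    proof (rule member_le_sum)
      show "(k + 1, r) \<in> nbr (k, r)" using r_in by (auto simp: nbr_def)
      fix w assume "w \<in> nbr (k, r) - {(k + 1, r)}"
      then show "0 \<le> G (k, r) w * h w"
        using G_nonneg[OF kS(1), of w] h0[of w] \<open>h (k, r) = 0\<close> nbr_subset[of "(k, r)"]
        by (cases "w = (k, r)") auto
    qed (rule finite_nbr)
    finally show ?thesis .
  qed

  \<comment> \<open>At high levels \<open>h\<close> equals \<open>T - C\<close>. Subtracting this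
    constant gives finite support and does not change \<open>Gop h\<close>.\<close>
  have "((\<lambda>z. \<pi> z * Gop (\<lambda>w. h w - (T - C)) z) has_sum 0) S"
  proof (rule stationary_pairing[OF \<pi>])
    show "finite ({..nat \<lceil>T + B\<rceil>} \<times> E)" "{..nat \<lceil>T + B\<rceil>} \<times> E \<subseteq> S"
      using finite_E by (auto simp: S_def)
    fix w assume w: "w \<in> S - {..nat \<lceil>T + B\<rceil>} \<times> E"
    then have "T + B \<le> real (fst w)" by (cases w) (auto simp: S_def, linarith)
    then show "h w - (T - C) = 0" using V(1)[of w] w T by (simp add: h_def)
  qed
  moreover have "Gop (\<lambda>w. h w - (T - C)) z = Gop h z" if "z \<in> S" for z
    using Gop_diff[of h "\<lambda>_. T - C" z] Gop_const[OF that] by simp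
  ultimately have "((\<lambda>z. \<pi> z * Gop h z) has_sum 0) S"
    using has_sum_cong[of S "\<lambda>z. \<pi> z * Gop (\<lambda>w. h w - (T - C)) z"] by simp
  \<comment> \<open>Adding \<open>K\<close> makes every summand nonnegative, so that partial sums
    over finite sets are at most \<open>K\<close>.\<close>
  from has_sum_add[OF this has_sum_cmult_right[OF \<pi>1, of K]]
  have sum_K: "((\<lambda>z. \<pi> z * (Gop h z + K)) has_sum K) S" by (simp add: algebra_simps)
  have le_K: "(\<Sum>z\<in>insert (k, r) F0. \<pi> z * (Gop h z + K)) \<le> K"
  proof (rule finite_sum_le_has_sum[OF sum_K])
    fix z assume "z \<in> S - insert (k, r) F0"
    then show "0 \<le> \<pi> z * (Gop h z + K)" using \<pi>0[of z] Gop_h_ge'[of z] by simp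
  qed (use F0 kS in auto)
  have "K * sum \<pi> F0 + \<epsilon> \<le> (\<Sum>z\<in>insert (k, r) F0. \<pi> z * K) + \<epsilon>"
    using F0 kS \<pi>0[of "(k, r)"] K(1)
    by (auto simp: sum_distrib_left mult.commute sum.insert_if)
  also have "\<epsilon> \<le> (\<Sum>z\<in>insert (k, r) F0. \<pi> z * Gop h z)"
  proof -
    have "\<epsilon> \<le> \<pi> (k, r) * Gop h (k, r)"
      unfolding \<epsilon>_def using Gop_h_k k(1) by simp
    also have "\<dots> \<le> (\<Sum>z\<in>insert (k, r) F0. \<pi> z * Gop h z)"
    proof (rule member_le_sum[where f = "\<lambda>z. \<pi> z * Gop h z"])
      fix z assume "z \<in> insert (k, r) F0 - {(k, r)}"
      then show "0 \<le> \<pi> z * Gop h z" using \<pi>0[of z] Gop_h_ge[of z] l(2)[of z] F0(2) by auto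
    qed (use F0 in auto)
    finally show ?thesis .
  qed
  also have "(\<Sum>z\<in>insert (k, r) F0. \<pi> z * K) + (\<Sum>z\<in>insert (k, r) F0. \<pi> z * Gop h z)
      = (\<Sum>z\<in>insert (k, r) F0. \<pi> z * (Gop h z + K))"
    by (simp add: distrib_left sum.distrib add.commute del: sum.insert)
  finally have "K * sum \<pi> F0 + \<epsilon> \<le> K" using le_K by simp
  \<comment> \<open>The mass of \<open>F0\<close> gives at least \<open>K - \<epsilon> / 2\<close>,
    which together with the gain \<open>\<epsilon>\<close> exceeds \<open>K\<close>.\<close>
  moreover have "1 - \<epsilon> / (2 * K) \<le> sum \<pi> F0" using F0(3) by (simp add: dist_real_def)
  then have "K * (1 - \<epsilon> / (2 * K)) \<le> K * sum \<pi> F0" using K(1) by simp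
  then have "K - \<epsilon> / 2 \<le> K * sum \<pi> F0" using K(1) by (simp add: right_diff_distrib)
  ultimately show False using \<epsilon> by simp
qed

subsection \<open>Negative mean drift\<close>

text \<open>
  Transition operator of the uniformized chain. It acts on functions, so that the \<open>n\<close>-step
  probabilities from \<open>(0, r)\<close> are obtained by applying the \<open>n\<close>-th power to indicators and no
  infinite sum is needed.
\<close>

definition uniformized :: "real \<Rightarrow> (nat \<times> 'a \<Rightarrow> real) \<Rightarrow> nat \<times> 'a \<Rightarrow> real" where
  "uniformized K h z = h z + Gop h z / K"

definition step_expectation :: "real \<Rightarrow> nat \<Rightarrow> (nat \<times> 'a \<Rightarrow> real) \<Rightarrow> real" where
  "step_expectation K n h = (uniformized K ^^ n) h (0, r)"

definition step_prob :: "real \<Rightarrow> nat \<Rightarrow> nat \<times> 'a \<Rightarrow> real" where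
  "step_prob K n y = step_expectation K n (indicator {y})"

lemma step_expectation_0: "step_expectation K 0 h = h (0, r)"
  by (simp add: step_expectation_def)

lemma step_expectation_Suc: "step_expectation K (Suc n) h = step_expectation K n (uniformized K h)"
  by (simp add: step_expectation_def funpow_Suc_right del: funpow.simps)

lemma step_expectation_add:
  "step_expectation K n (\<lambda>z. h z + k z) = step_expectation K n h + step_expectation K n k"
proof (induction n arbitrary: h k)
  case (Suc n)
  have "uniformized K (\<lambda>z. h z + k z) = (\<lambda>z. uniformized K h z + uniformized K k z)"
    by (auto simp: uniformized_def Gop_def sum.distrib distrib_left add_divide_distrib)
  then show ?case by (simp add: step_expectation_Suc Suc)
qed (simp add: step_expectation_0)

lemma step_expectation_cmult:
  "step_expectation K n (\<lambda>z. a * h z) = a * step_expectation K n h"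
proof (induction n arbitrary: h)
  case (Suc n)
  have "uniformized K (\<lambda>z. a * h z) = (\<lambda>z. a * uniformized K h z)"
    by (auto simp: uniformized_def Gop_def sum_distrib_left distrib_left mult_ac)
  then show ?case by (simp add: step_expectation_Suc Suc)
qed (simp add: step_expectation_0)

lemma step_expectation_sum:
  "finite F \<Longrightarrow> step_expectation K n (\<lambda>z. \<Sum>y\<in>F. c y * indicator {y} z)
    = (\<Sum>y\<in>F. c y * step_prob K n y)"
proof (induction F rule: finite_induct)
  case empty
  then show ?case using step_expectation_cmult[of K n 0 "\<lambda>_. 0"] by simp
next
  case (insert y F)
  have "step_expectation K n (\<lambda>z. \<Sum>x\<in>insert y F. c x * indicator {x} z)
      = step_expectation K n (\<lambda>z. c y * indicator {y} z + (\<Sum>x\<in>F. c x * indicator {x} z))"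
    unfolding sum.insert[OF insert.hyps] by (rule refl)
  with insert show ?case
    unfolding step_expectation_add step_expectation_cmult by (simp add: step_prob_def)
qed

text \<open>Since \<open>K\<close> bounds the diagonal entries of \<open>G\<close>, the holding
  probabilities \<open>1 + G z z / K\<close> are nonnegative, and so is the whole transition
  operator.\<close>

lemma uniformized_mono:
  assumes K: "0 < K" "\<And>z w. z \<in> S \<Longrightarrow> w \<in> S \<Longrightarrow> \<bar>G z w\<bar> \<le> K"
    and "\<And>w. w \<in> S \<Longrightarrow> h w \<le> k w" and z: "z \<in> S"
  shows "uniformized K h z \<le> uniformized K k z"
proof -
  define d where "d w = k w - h w" for w
  have d: "0 \<le> d w" if "w \<in> S" for w using assms(3)[OF that] by (simp add: d_def)
  have "0 \<le> G z w * d w" if "w \<in> nbr z - {z}" for w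
    using G_nonneg[OF z, of w] d[of w] that nbr_subset[of z] by auto
  then have "G z z * d z \<le> Gop d z"
    unfolding Gop_def using finite_nbr self_in_nbr[OF z]
    by (subst sum.remove[of _ z]) (auto intro!: sum_nonneg)
  moreover have "- K * d z \<le> G z z * d z"
    using K(2)[OF z z] d[OF z] by (intro mult_right_mono) auto
  ultimately have "- d z \<le> Gop d z / K" using K(1) by (simp add: field_simps)
  then show ?thesis
    using Gop_diff[of k h z] by (simp add: uniformized_def d_def[abs_def] diff_divide_distrib)
qed

lemma step_expectation_mono:
  assumes K: "0 < K" "\<And>z w. z \<in> S \<Longrightarrow> w \<in> S \<Longrightarrow> \<bar>G z w\<bar> \<le> K"
    and hk: "\<And>w. w \<in> S \<Longrightarrow> h w \<le> k w"
  shows "step_expectation K n h \<le> step_expectation K n k"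
  using hk
proof (induction n arbitrary: h k)
  case 0
  then show ?case using r_in by (simp add: step_expectation_0 S_def)
next
  case (Suc n)
  then show ?case unfolding step_expectation_Suc
    by (intro Suc.IH uniformized_mono K) auto
qed

lemma step_expectation_cong:
  assumes K: "0 < K" "\<And>z w. z \<in> S \<Longrightarrow> w \<in> S \<Longrightarrow> \<bar>G z w\<bar> \<le> K"
    and hk: "\<And>w. w \<in> S \<Longrightarrow> h w = k w"
  shows "step_expectation K n h = step_expectation K n k"
  using step_expectation_mono[OF K, of h k n] step_expectation_mono[OF K, of k h n] hk
  by (metis order_antisym order_refl)

lemma step_expectation_const:
  assumes K: "0 < K" "\<And>z w. z \<in> S \<Longrightarrow> w \<in> S \<Longrightarrow> \<bar>G z w\<bar> \<le> K"
  shows "step_expectation K n (\<lambda>_. a) = a"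
proof (induction n)
  case (Suc n)
  have "step_expectation K n (uniformized K (\<lambda>_. a)) = step_expectation K n (\<lambda>_. a)"
    by (rule step_expectation_cong[OF K]) (simp_all add: uniformized_def Gop_const)
  then show ?case by (simp add: step_expectation_Suc Suc)
qed (simp add: step_expectation_0)

text \<open>The forward equation, whereas the powers of the operator give the backward one. On
  \<open>S\<close>, one step applied to the indicator of \<open>y\<close> is a finite combination of
  indicators of neighbours, by symmetry of \<open>nbr\<close>.\<close>

lemma step_prob_Suc:
  assumes K: "0 < K" "\<And>z w. z \<in> S \<Longrightarrow> w \<in> S \<Longrightarrow> \<bar>G z w\<bar> \<le> K" and y: "y \<in> S"
  shows "step_prob K (Suc n) y = step_prob K n y + (\<Sum>x\<in>nbr y. step_prob K n x * G x y) / K"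
proof -
  have "uniformized K (indicator {y}) z
      = indicator {y} z + (\<Sum>x\<in>nbr y. G x y / K * indicator {x} z)" if z: "z \<in> S" for z
  proof -
    have "Gop (indicator {y}) z = (if y \<in> nbr z then G z y else 0)"
      unfolding Gop_def indicator_def using finite_nbr by simp
    also have "\<dots> = (\<Sum>x\<in>nbr y. G x y * indicator {x} z)"
      using nbr_sym[OF y z] finite_nbr by (simp add: indicator_def)
    finally show ?thesis by (simp add: uniformized_def sum_divide_distrib)
  qed
  then have "step_prob K (Suc n) y = step_expectation K n
      (\<lambda>z. indicator {y} z + (\<Sum>x\<in>nbr y. G x y / K * indicator {x} z))"
    unfolding step_prob_def step_expectation_Suc by (intro step_expectation_cong[OF K]) auto
  then show ?thesis
    unfolding step_expectation_add step_expectation_sum[OF finite_nbr]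
    by (simp add: step_prob_def sum_divide_distrib mult.commute)
qed

lemma step_prob_nonneg:
  assumes K: "0 < K" "\<And>z w. z \<in> S \<Longrightarrow> w \<in> S \<Longrightarrow> \<bar>G z w\<bar> \<le> K"
  shows "0 \<le> step_prob K n y"
  using step_expectation_mono[OF K, of "\<lambda>_. 0" "indicator {y}" n]
  by (simp add: step_expectation_const[OF K] step_prob_def)

lemma sum_step_prob_le_1:
  assumes K: "0 < K" "\<And>z w. z \<in> S \<Longrightarrow> w \<in> S \<Longrightarrow> \<bar>G z w\<bar> \<le> K" and F: "finite F"
  shows "(\<Sum>y\<in>F. step_prob K n y) \<le> 1"
proof -
  have "(\<Sum>y\<in>F. step_prob K n y) = step_expectation K n (\<lambda>z. \<Sum>y\<in>F. 1 * indicator {y} z)"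
    unfolding step_expectation_sum[OF F] by simp
  also have "\<dots> \<le> step_expectation K n (\<lambda>_. 1)"
  proof (rule step_expectation_mono[OF K])
    show "(\<Sum>y\<in>F. 1 * indicator {y} w) \<le> (1 :: real)" for w
      using F by (simp add: indicator_def of_bool_def)
  qed
  finally show ?thesis by (simp add: step_expectation_const[OF K])
qed

text \<open>Foster's argument: \<open>V\<close> is nonnegative, and \<open>Gop V\<close> is at most
  \<open>\<delta> + b\<close> on the levels below \<open>M\<close> and \<open>\<delta>\<close>
  above. Summed over \<open>n\<close> steps, the loss of order \<open>n\<close> must be made up by
  visits to the low levels.\<close>

lemma occupation_lower_bound:
  assumes K: "0 < K" "\<And>z w. z \<in> S \<Longrightarrow> w \<in> S \<Longrightarrow> \<bar>G z w\<bar> \<le> K"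
    and g: "\<And>x. x \<in> E \<Longrightarrow> drift x + (\<Sum>y\<in>E. H x y * g y) = \<delta>"
    and \<delta>: "\<delta> < 0"
  shows "\<exists>\<epsilon>>0. \<exists>b. \<forall>n. real n * \<epsilon> - b \<le> (\<Sum>k<n. \<Sum>y\<in>{..<M} \<times> E. step_prob K k y)"
proof -
  define C where "C = {..<M} \<times> E"
  have C: "finite C" by (simp add: C_def finite_E)
  define B where "B = (\<Sum>x\<in>E. \<bar>g x\<bar>)"
  have B: "\<bar>g x\<bar> \<le> B" if "x \<in> E" for x
    unfolding B_def using finite_E that by (auto intro: member_le_sum)
  \<comment> \<open>The shift by \<open>B\<close> makes \<open>V\<close> nonnegative on
    \<open>S\<close>.\<close>
  define V where "V w = real (fst w) + g (snd w) + B" for w :: "nat \<times> 'a"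
  have V0: "0 \<le> V w" if "w \<in> S" for w
    using B[of "snd w"] that by (auto simp: V_def S_def abs_le_iff)
  \<comment> \<open>Chosen so that \<open>\<delta> + b\<close> bounds \<open>Gop V\<close> on
    \<open>C\<close>; the summand \<open>- \<delta>\<close> also makes \<open>b\<close>
    positive.\<close>
  define b where "b = (\<Sum>z\<in>C. \<bar>Gop V z\<bar>) - \<delta>"
  have b: "0 < b" unfolding b_def using \<delta> by (simp add: add_nonneg_pos sum_nonneg diff_conv_add_uminus del: add_uminus_conv_diff)
  have V_above: "Gop V z = \<delta>" if "z \<in> S" "M \<le> fst z" for z
  proof -
    have "Gop V z = Gop (\<lambda>w. real (fst w) + g (snd w)) z - Gop (\<lambda>_. - B) z"
      by (simp add: V_def[abs_def] flip: Gop_diff)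
    then show ?thesis
      using Gop_lyapunov[OF g, of "fst z" "snd z"] Gop_const that by simp
  qed
  have Gop_V: "Gop V z \<le> \<delta> + (\<Sum>y\<in>C. b * indicator {y} z)" if z: "z \<in> S" for z
  proof (cases "z \<in> C")
    case True
    then have "\<bar>Gop V z\<bar> \<le> (\<Sum>z\<in>C. \<bar>Gop V z\<bar>)" using C by (intro member_le_sum) auto
    then show ?thesis using True C by (simp add: b_def indicator_def)
  next
    case False
    then have "M \<le> fst z" using z by (cases z) (auto simp: C_def S_def)
    then show ?thesis using V_above[OF z] False C by (auto simp: indicator_def)
  qed
  have step: "step_expectation K (Suc n) V
      \<le> step_expectation K n V + (\<delta> + b * (\<Sum>y\<in>C. step_prob K n y)) / K" for n
  proof -
    have "step_expectation K (Suc n) V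
        \<le> step_expectation K n (\<lambda>z. V z + (\<delta> / K + (\<Sum>y\<in>C. b / K * indicator {y} z)))"
      unfolding step_expectation_Suc
    proof (rule step_expectation_mono[OF K])
      fix z assume "z \<in> S"
      then have "Gop V z / K \<le> (\<delta> + (\<Sum>y\<in>C. b * indicator {y} z)) / K"
        using Gop_V K(1) by (intro divide_right_mono) auto
      then show "uniformized K V z \<le> V z + (\<delta> / K + (\<Sum>y\<in>C. b / K * indicator {y} z))"
        by (simp add: uniformized_def add_divide_distrib sum_divide_distrib)
    qed auto
    also have "\<dots> = step_expectation K n V + (\<delta> + b * (\<Sum>y\<in>C. step_prob K n y)) / K"
      unfolding step_expectation_add step_expectation_sum[OF C]
      by (simp add: step_expectation_const K add_divide_distrib sum_distrib_left sum_divide_distrib)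
    finally show ?thesis .
  qed
  have total: "step_expectation K n V
      \<le> V (0, r) + (real n * \<delta> + b * (\<Sum>k<n. \<Sum>y\<in>C. step_prob K k y)) / K" for n
  proof (induction n)
    case (Suc n)
    show ?case using step[of n] Suc.IH by (simp add: add_divide_distrib distrib_left distrib_right)
  qed (simp add: step_expectation_0)
  have "real n * (- \<delta> / b) - V (0, r) * K / b \<le> (\<Sum>k<n. \<Sum>y\<in>C. step_prob K k y)" for n
  proof -
    have "0 \<le> step_expectation K n V"
      using step_expectation_mono[OF K, of "\<lambda>_. 0" V n] V0 by (simp add: step_expectation_const[OF K])
    with total[of n] have "0 \<le> V (0, r) + (real n * \<delta> + b * (\<Sum>k<n. \<Sum>y\<in>C. step_prob K k y)) / K"
      by linarith
    then show ?thesis using K(1) b by (simp add: field_simps)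
  qed
  moreover have "0 < - \<delta> / b" using \<delta> b by (intro divide_pos_pos) auto
  ultimately show ?thesis unfolding C_def by blast
qed

lemma stationary_exists:
  assumes g: "\<And>x. x \<in> E \<Longrightarrow> drift x + (\<Sum>y\<in>E. H x y * g y) = \<delta>"
    and \<delta>: "\<delta> < 0"
  shows "\<exists>\<pi>. stationary_prob_vector S G \<pi>"
proof -
  obtain K where K: "0 < K" "\<And>z w. z \<in> S \<Longrightarrow> w \<in> S \<Longrightarrow> \<bar>G z w\<bar> \<le> K"
    using G_bounded by blast
  \<comment> \<open>Cesaro averages. Division by zero makes \<open>a 0\<close> the zero vector, so
    the bounds below hold for every \<open>n\<close>.\<close>
  define a where "a n y = (\<Sum>k<n. step_prob K k y) / real n" for n y
  have step_le_1: "step_prob K n y \<le> 1" for n y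
    using sum_step_prob_le_1[OF K, of "{y}" n] by simp
  have sum_a: "(\<Sum>y\<in>F. a n y) = (\<Sum>k<n. \<Sum>y\<in>F. step_prob K k y) / real n" for n F
    unfolding a_def by (subst sum.swap) (simp add: sum_divide_distrib)
  have a_sum_le_1: "(\<Sum>y\<in>F. a n y) \<le> 1" if "finite F" for n F
  proof -
    have "(\<Sum>k<n. \<Sum>y\<in>F. step_prob K k y) \<le> (\<Sum>k<n. 1)"
      by (intro sum_mono sum_step_prob_le_1[OF K] that)
    then show ?thesis unfolding sum_a by (cases "n = 0") (auto simp: field_simps)
  qed
  have a_nonneg: "0 \<le> a n y" for n y
    unfolding a_def by (intro divide_nonneg_nonneg sum_nonneg step_prob_nonneg[OF K]) auto
  have "a n y \<in> {0..1}" for n y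
    using a_nonneg a_sum_le_1[of "{y}" n] by simp
  then obtain v \<rho> where \<rho>: "strict_mono (\<rho> :: nat \<Rightarrow> nat)" and v: "\<And>y. (\<lambda>k. a (\<rho> k) y) \<longlonglongrightarrow> v y"
    using bounded_pointwise_convergent_subseq[of a] by blast
  have \<rho>_inf: "filterlim \<rho> sequentially sequentially" using \<rho> by (rule filterlim_subseq)
  have v0: "0 \<le> v y" for y
    using v by (rule LIMSEQ_le_const) (use a_nonneg in auto)
  have v1: "(\<Sum>y\<in>F. v y) \<le> 1" if "finite F" for F
    using tendsto_sum[OF v] by (rule LIMSEQ_le_const2) (use a_sum_le_1[OF that] in auto)
  have balance: "(\<Sum>x\<in>nbr y. v x * G x y) = 0" if y: "y \<in> S" for y
  proof -
    \<comment> \<open>By the forward equation the sum telescopes, so the averages violate balance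
      only by a term of order \<open>1 / n\<close>. Each column is finite, hence balance passes to
      the pointwise limit.\<close>
    have "(\<Sum>x\<in>nbr y. a n x * G x y) = K * (step_prob K n y - step_prob K 0 y) / real n" for n
    proof -
      have "step_prob K n y - step_prob K 0 y
          = (\<Sum>k<n. (\<Sum>x\<in>nbr y. step_prob K k x * G x y) / K)"
        using sum_lessThan_telescope[of "\<lambda>k. step_prob K k y" n]
        by (simp add: step_prob_Suc K y)
      also have "\<dots> = (\<Sum>x\<in>nbr y. (\<Sum>k<n. step_prob K k x) * G x y) / K"
        unfolding sum_divide_distrib[symmetric] sum_distrib_right
        by (subst sum.swap) (rule refl)
      finally have "K * (step_prob K n y - step_prob K 0 y)
          = (\<Sum>x\<in>nbr y. (\<Sum>k<n. step_prob K k x) * G x y)"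
        using K(1) by simp
      then show ?thesis unfolding a_def by (simp flip: sum_divide_distrib)
    qed
    moreover have "(\<lambda>n. K * (step_prob K n y - step_prob K 0 y) / real n) \<longlonglongrightarrow> 0"
    proof (rule Lim_null_comparison)
      show "\<forall>\<^sub>F n in sequentially. norm (K * (step_prob K n y - step_prob K 0 y) / real n) \<le> K / real n"
      proof (intro always_eventually allI)
        fix n
        have "\<bar>step_prob K n y - step_prob K 0 y\<bar> \<le> 1"
          using step_prob_nonneg[OF K, of n y] step_prob_nonneg[OF K, of 0 y]
            step_le_1[of n y] step_le_1[of 0 y] by linarith
        then show "norm (K * (step_prob K n y - step_prob K 0 y) / real n) \<le> K / real n"
          using K(1) by (auto simp: abs_mult intro!: divide_right_mono mult_left_le)
      qed
      show "(\<lambda>n. K / real n) \<longlonglongrightarrow> 0" by (rule lim_const_over_n)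
    qed
    ultimately have "(\<lambda>n. \<Sum>x\<in>nbr y. a n x * G x y) \<longlonglongrightarrow> 0" by simp
    from filterlim_compose[OF this \<rho>_inf]
    have "(\<lambda>k. \<Sum>x\<in>nbr y. a (\<rho> k) x * G x y) \<longlonglongrightarrow> 0" .
    moreover have "(\<lambda>k. \<Sum>x\<in>nbr y. a (\<rho> k) x * G x y) \<longlonglongrightarrow> (\<Sum>x\<in>nbr y. v x * G x y)"
      by (intro tendsto_sum tendsto_mult_right v)
    ultimately show ?thesis using LIMSEQ_unique by blast
  qed

  define C where "C = {..<M} \<times> E"
  have C: "finite C" "C \<subseteq> S" by (auto simp: C_def S_def finite_E)
  obtain \<epsilon> b where \<epsilon>: "0 < \<epsilon>" and
    eb: "\<And>n. real n * \<epsilon> - b \<le> (\<Sum>k<n. \<Sum>y\<in>C. step_prob K k y)"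
    using occupation_lower_bound[OF K g \<delta>] unfolding C_def by blast
  \<comment> \<open>Mass may escape to infinity in the pointwise limit, but not from the finite set
    \<open>C\<close>. So \<open>v\<close> is nonzero and can be normalised.\<close>
  have "\<epsilon> - 0 \<le> (\<Sum>y\<in>C. v y)"
  proof (rule tendsto_le)
    show "(\<lambda>k. \<Sum>y\<in>C. a (\<rho> k) y) \<longlonglongrightarrow> (\<Sum>y\<in>C. v y)" by (intro tendsto_sum v)
    have "(\<lambda>n. \<epsilon> - b / real n) \<longlonglongrightarrow> \<epsilon> - 0"
      by (intro tendsto_intros lim_const_over_n)
    from filterlim_compose[OF this \<rho>_inf] show "(\<lambda>k. \<epsilon> - b / real (\<rho> k)) \<longlonglongrightarrow> \<epsilon> - 0" .
    have "\<forall>\<^sub>F k in sequentially. 0 < \<rho> k"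
      using eventually_compose_filterlim[OF eventually_gt_at_top \<rho>_inf] by blast
    then show "\<forall>\<^sub>F k in sequentially. \<epsilon> - b / real (\<rho> k) \<le> (\<Sum>y\<in>C. a (\<rho> k) y)"
    proof eventually_elim
      case (elim k)
      have "\<epsilon> - b / real (\<rho> k) = (real (\<rho> k) * \<epsilon> - b) / real (\<rho> k)"
        using elim by (simp add: field_simps)
      also have "\<dots> \<le> (\<Sum>y\<in>C. a (\<rho> k) y)"
        unfolding sum_a by (intro divide_right_mono eb) simp
      finally show ?case .
    qed
  qed simp
  then have C_pos: "0 < (\<Sum>y\<in>C. v y)" using \<epsilon> by simp

  have "v summable_on S"
    by (rule nonneg_bounded_partial_sums_imp_summable_on[where C = 1])
      (use v0 v1 in \<open>auto intro!: eventually_finite_subsets_at_top_weakI\<close>)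
  then obtain t where t: "(v has_sum t) S" by (auto simp: summable_on_def)
  have "(\<Sum>y\<in>C. v y) \<le> t" by (rule finite_sum_le_has_sum[OF t]) (use C v0 in auto)
  with C_pos have t0: "0 < t" by simp
  have "stationary_prob_vector S G (\<lambda>z. v z / t)"
    unfolding stationary_prob_vector_def
  proof (intro conjI ballI)
    fix x show "0 \<le> v x / t" using v0 t0 by simp
  next
    show "((\<lambda>z. v z / t) has_sum 1) S"
      using has_sum_cmult_left[OF t, of "1 / t"] t0 by simp
  next
    fix y assume y: "y \<in> S"
    show "((\<lambda>x. v x / t * G x y) has_sum 0) S"
    proof (rule has_sum_finite_neutralI[OF finite_nbr[of y] nbr_subset])
      show "v x / t * G x y = 0" if "x \<in> S - nbr y" for x
        using G_eq_0[of x y] nbr_sym[OF y, of x] y that by simp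
      show "0 = (\<Sum>x\<in>nbr y. v x / t * G x y)"
        using balance[OF y] by (simp flip: sum_divide_distrib)
    qed
  qed
  then show ?thesis by blast
qed

theorem stationary_iff_drift_neg:
  assumes \<phi>: "stationary_prob_vector E H \<phi>"
  shows "(\<exists>\<pi>. stationary_prob_vector S G \<pi>) \<longleftrightarrow> (\<Sum>x\<in>E. \<phi> x * drift x) < 0"
proof -
  obtain g \<delta> where g: "\<And>x. x \<in> E \<Longrightarrow> drift x + (\<Sum>y\<in>E. H x y * g y) = \<delta>"
    using poisson_equation[of drift] by blast
  have "(\<Sum>x\<in>E. \<phi> x * drift x) = \<delta>" using mean_drift[OF \<phi>] g by blast
  moreover have "\<exists>\<pi>. stationary_prob_vector S G \<pi>" if "\<delta> < 0"
    using stationary_exists g that by blast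
  moreover have False if "0 \<le> \<delta>" "stationary_prob_vector S G \<pi>" for \<pi>
    using no_stationary g that by blast
  ultimately show ?thesis by force
qed

end

section \<open>The queueing-inventory process\<close>

text \<open>Bounds a rate below by one of its transitions, without deciding whether the targets of
  others coincide with it.\<close>

lemma le_sum_of_ifs:
  fixes a1 a2 a3 a4 :: real and b1 b2 b3 b4 :: bool
  assumes "0 \<le> a1" "0 \<le> a2" "0 \<le> a3" "0 \<le> a4"
  defines "t \<equiv> (if b1 then a1 else 0) + (if b2 then a2 else 0) + (if b3 then a3 else 0)
    + (if b4 then a4 else 0)"
  shows "b1 \<Longrightarrow> a1 \<le> t" and "b2 \<Longrightarrow> a2 \<le> t" and "b4 \<Longrightarrow> a4 \<le> t"
  unfolding t_def using assms(1-4) by simp_all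

section \<open>Phases in the coordinates inventory, active servers and hall\<close>

locale queue_inventory_params = queue_inventory +
  assumes c_pos: "1 \<le> c" and c_le_N: "c \<le> N"
    and pos: "0 < lam" "0 < \<theta>" "0 < \<mu>" "0 < \<beta>" "0 < \<eta>" "0 < p"
begin

lemma mk_phase_in_phases:
  assumes "n \<le> c"
  shows "mk_phase i2 n i6 \<in> phases \<longleftrightarrow>
    i2 \<le> S \<and> i6 \<le> N \<and> (1 \<le> n \<and> n \<le> max i2 i6 \<or> n = 0 \<and> i2 \<in> {0, Q})"
  unfolding mk_phase_def phases_def mem_Collect_eq prod.case
  by (simp only: diff_diff_cancel[OF assms] diff_le_self simp_thms)

lemma phases_cases:
  assumes "x \<in> phases"
  obtains i2 n i6 where "x = mk_phase i2 n i6" "n \<le> c" "i2 \<le> S" "i6 \<le> N"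
    "1 \<le> n \<and> n \<le> max i2 i6 \<or> n = 0 \<and> i2 \<in> {0, Q}"
proof -
  obtain i2 i3 i4 i5 i6 where x: "x = (i2, i3, i4, i5, i6)" by (cases x rule: prod_cases5)
  have E: "i2 \<le> S \<and> i3 \<le> c \<and> i6 \<le> N \<and>
     i4 = min (c - i3) (min i2 i6) \<and> i5 = (c - i3) - i4 \<and>
     (1 \<le> c - i3 \<and> c - i3 \<le> max i2 i6 \<or> c - i3 = 0 \<and> i2 \<in> {0, Q})"
    using assms unfolding x phases_def mem_Collect_eq prod.case .
  then have eqs: "c - (c - i3) = i3" "i4 = min (c - i3) (min i2 i6)" "i5 = (c - i3) - i4" by simp_all
  have "x = mk_phase i2 (c - i3) i6" unfolding x mk_phase_def by (simp only: eqs)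
  then show ?thesis using E by (intro that[of i2 "c - i3" i6] diff_le_self) blast+
qed

lemma finite_phases: "finite phases"
proof (rule finite_subset)
  show "phases \<subseteq> {..S} \<times> {..c} \<times> {..c} \<times> {..c} \<times> {..N}"
    unfolding phases_def by (auto intro: le_trans[OF min.cobounded1])
qed auto

lemma mk_phase_eq_iff:
  assumes "n \<le> c" "n' \<le> c"
  shows "mk_phase i2 n i6 = mk_phase i2' n' i6' \<longleftrightarrow> i2 = i2' \<and> n = n' \<and> i6 = i6'"
proof
  assume "mk_phase i2 n i6 = mk_phase i2' n' i6'"
  then have "i2 = i2'" "c - n = c - n'" "i6 = i6'"
    unfolding mk_phase_def prod.inject by blast+
  moreover from \<open>c - n = c - n'\<close> have "n = n'" using assms by arith
  ultimately show "i2 = i2' \<and> n = n' \<and> i6 = i6'" by blast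
qed simp

section \<open>Transition rates and row sums of the blocks\<close>

declare rate.simps [simp del]

lemma rate_nonneg: "0 \<le> rate z t"
proof -
  obtain i i2 i3 i4 i5 i6 where z: "z = (i, (i2, i3, i4, i5, i6))" by (cases z rule: prod_cases6)
  have if_nonneg: "0 \<le> (if b then a else 0)" if "0 \<le> a" for a :: real and b
    using that by simp
  show ?thesis
    unfolding z rate.simps Let_def using pos by (intro add_nonneg_nonneg if_nonneg) simp_all
qed

lemma rate_mk_phase:
  assumes "n \<le> c"
  shows "rate (i, mk_phase i2 n i6) t =
     (if i6 < N \<and> t = (i, mk_phase i2 n (i6 + 1)) then lam else 0)
       + (if i6 = N \<and> t = (i + 1, mk_phase i2 n N) then p * lam else 0)
       + (if 1 \<le> i \<and> i6 < N \<and> t = (i - 1, mk_phase i2 n (i6 + 1)) then real i * \<theta> else 0)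
       + (if 1 \<le> min n (min i2 i6) \<and> t = (i, mk_phase (i2 - 1)
            (if n \<le> max (i2 - 1) (i6 - 1) then n else n - 1) (i6 - 1))
          then real (min n (min i2 i6)) * \<mu> else 0)
       + (if i2 \<le> s \<and> t = (i, mk_phase (i2 + Q) n i6) then \<beta> else 0)
       + (if n < c \<and> n + 1 \<le> max i2 i6 \<and> t = (i, mk_phase i2 (n + 1) i6) then \<eta> else 0)"
  unfolding mk_phase_def[of i2 n i6] rate.simps Let_def using assms by simp

lemma rate_up:
  assumes "n \<le> c" "i6 \<le> N"
  shows "rate (i, mk_phase i2 n i6) (Suc i, y)
    = (if i6 = N \<and> y = mk_phase i2 n i6 then p * lam else 0)"
  unfolding rate_mk_phase[OF assms(1)] by auto

lemma rate_down:
  assumes "n \<le> c" "1 \<le> i"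
  shows "rate (i, mk_phase i2 n i6) (i - 1, y)
    = (if i6 < N \<and> y = mk_phase i2 n (Suc i6) then real i * \<theta> else 0)"
proof -
  have "i - 1 \<noteq> i" "i - 1 \<noteq> i + 1" using assms by auto
  then show ?thesis unfolding rate_mk_phase[OF assms(1)] prod.inject using assms(2) by auto
qed

lemma H_up_eq: "x \<in> phases \<Longrightarrow> H_up x y = rate (i, x) (Suc i, y)"
  unfolding H_up_def by (erule phases_cases) (simp add: rate_up)

lemma sum_H_up:
  assumes "x \<in> phases" "x = (i2, i3, i4, i5, i6)"
  shows "(\<Sum>y\<in>phases. H_up x y) = (if i6 = N then p * lam else 0)"
proof -
  obtain j2 n j6 where x: "x = mk_phase j2 n j6" "n \<le> c" "j6 \<le> N"
    using assms(1) by (elim phases_cases)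
  have "j6 = i6" using assms(2) x(1) by (simp add: mk_phase_def)
  have "H_up x y = (if y = x then (if i6 = N then p * lam else 0) else 0)" for y
    unfolding H_up_def x(1) One_nat_def rate_up[OF x(2,3)] using \<open>j6 = i6\<close> by simp
  then show ?thesis using assms(1) finite_phases by simp
qed

lemma sum_H_down:
  assumes "x \<in> phases" "x = (i2, i3, i4, i5, i6)" "1 \<le> i"
  shows "(\<Sum>y\<in>phases. H_down i x y) = (if i6 < N then real i * \<theta> else 0)"
proof -
  obtain j2 n j6 where x: "x = mk_phase j2 n j6" "n \<le> c" "j2 \<le> S" "j6 \<le> N"
    "1 \<le> n \<and> n \<le> max j2 j6 \<or> n = 0 \<and> j2 \<in> {0, Q}"
    using assms(1) by (elim phases_cases)
  have "j6 = i6" using assms(2) x(1) by (simp add: mk_phase_def)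
  have "H_down i x y
      = (if y = mk_phase j2 n (Suc j6) then (if i6 < N then real i * \<theta> else 0) else 0)" for y
    unfolding H_down_def x(1) rate_down[OF x(2) assms(3)] using \<open>j6 = i6\<close> by simp
  \<comment> \<open>A retrial does not decrease \<open>max j2 j6\<close>, so its target is again a
    phase and the row sum captures the full rate.\<close>
  moreover have "mk_phase j2 n (Suc j6) \<in> phases" if "i6 < N"
    using x that \<open>j6 = i6\<close> by (auto simp: mk_phase_in_phases)
  ultimately show ?thesis using finite_phases by simp
qed

lemma H_within_nonneg: "x \<noteq> y \<Longrightarrow> 0 \<le> H_within i x y"
  using rate_nonneg[of "(i, x)" "(i, y)"] by (simp add: H_within_def)

lemma sum_H_within:
  assumes "x \<in> phases"
  shows "(\<Sum>y\<in>phases. H_within i x y)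
    = (\<Sum>y\<in>phases. rate (i, x) (i, y)) - (\<Sum>t \<in> {i - 1..i + 1} \<times> phases. rate (i, x) t)"
  unfolding H_within_def sum_subtractf using assms finite_phases by (simp only: sum.delta' if_True)

lemma sum_rate_levels:
  "finite J \<Longrightarrow>
    (\<Sum>t \<in> J \<times> phases. rate (i, x) t) = (\<Sum>j\<in>J. \<Sum>y\<in>phases. rate (i, x) (j, y))"
  unfolding sum.cartesian_product by (rule sum.cong) auto

lemma H_row_sum:
  assumes x: "x \<in> phases" and i: "1 \<le> i"
  shows "(\<Sum>y\<in>phases. H_down i x y + H_within i x y + H_up x y) = 0"
proof -
  \<comment> \<open>For \<open>1 \<le> i\<close> the diagonal correction runs over three distinct
    levels, one for each block.\<close>
  have levels: "{i - 1..i + 1} = {i - 1, i, Suc i}" and neq: "i - 1 \<noteq> i" "i - 1 \<noteq> Suc i" "i \<noteq> Suc i"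
    using i by auto
  have "(\<Sum>t \<in> {i - 1..i + 1} \<times> phases. rate (i, x) t)
      = (\<Sum>y\<in>phases. rate (i, x) (i - 1, y)) + ((\<Sum>y\<in>phases. rate (i, x) (i, y))
        + (\<Sum>y\<in>phases. rate (i, x) (Suc i, y)))"
    unfolding levels using neq by (simp add: sum_rate_levels del: One_nat_def)
  then show ?thesis
    unfolding sum.distrib sum_H_within[OF x] H_down_def H_up_eq[OF x, of _ i] by linarith
qed

lemma H_row_sum_0:
  assumes x: "x \<in> phases"
  shows "(\<Sum>y\<in>phases. H_within 0 x y + H_up x y) = 0"
proof -
  have levels: "{0 - 1..0 + 1} = {0, Suc 0}" by auto
  have "(\<Sum>t \<in> {0 - 1..0 + 1} \<times> phases. rate (0, x) t)
      = (\<Sum>y\<in>phases. rate (0, x) (0, y)) + (\<Sum>y\<in>phases. rate (0, x) (Suc 0, y))"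
    unfolding levels by (simp add: sum_rate_levels)
  then show ?thesis
    unfolding sum.distrib sum_H_within[OF x] H_up_eq[OF x, of _ 0] by linarith
qed

section \<open>Within-level transitions and reachability\<close>

lemma rate_within:
  assumes "n \<le> c"
  shows "rate (i, mk_phase i2 n i6) (i, y) =
     (if i6 < N \<and> y = mk_phase i2 n (Suc i6) then lam else 0)
       + (if 1 \<le> min n (min i2 i6) \<and> y = mk_phase (i2 - 1)
            (if n \<le> max (i2 - 1) (i6 - 1) then n else n - 1) (i6 - 1)
          then real (min n (min i2 i6)) * \<mu> else 0)
       + (if i2 \<le> s \<and> y = mk_phase (i2 + Q) n i6 then \<beta> else 0)
       + (if n < c \<and> n + 1 \<le> max i2 i6 \<and> y = mk_phase i2 (Suc n) i6 then \<eta> else 0)"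
proof -
  have no_retrial: "(1 \<le> i \<and> i6 < N \<and> (i, y) = (i - 1, z)) = False" for z by (cases i) simp_all
  have no_up: "(i6 = N \<and> (i, y) = (i + 1, z)) = False" for z by simp
  show ?thesis
    unfolding rate_mk_phase[OF assms] no_retrial no_up
    by (simp only: prod.inject simp_thms if_False add_0_right Suc_eq_plus1)
qed

lemma rate_arrival:
  "n \<le> c \<Longrightarrow> i6 < N \<Longrightarrow> lam \<le> rate (i, mk_phase i2 n i6) (i, mk_phase i2 n (Suc i6))"
  unfolding rate_within by (rule le_sum_of_ifs(1)) (use pos in auto)

lemma rate_service:
  assumes "n \<le> c" and busy: "1 \<le> min n (min i2 i6)"
  shows "\<mu> \<le> rate (i, mk_phase i2 n i6)
    (i, mk_phase (i2 - 1) (if n \<le> max (i2 - 1) (i6 - 1) then n else n - 1) (i6 - 1))"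
proof -
  have "1 * \<mu> \<le> real (min n (min i2 i6)) * \<mu>"
    using busy pos by (intro mult_right_mono) auto
  also have "\<dots> \<le> rate (i, mk_phase i2 n i6)
      (i, mk_phase (i2 - 1) (if n \<le> max (i2 - 1) (i6 - 1) then n else n - 1) (i6 - 1))"
    unfolding rate_within[OF assms(1)]
    by (rule le_sum_of_ifs(2)) (use busy pos in simp_all)
  finally show ?thesis by simp
qed

lemma rate_vacation:
  "n < c \<Longrightarrow> n + 1 \<le> max i2 i6 \<Longrightarrow>
    \<eta> \<le> rate (i, mk_phase i2 n i6) (i, mk_phase i2 (Suc n) i6)"
  unfolding rate_within[OF less_imp_le] by (rule le_sum_of_ifs(3)) (use pos in simp_all)

text \<open>Arrivals fill the hall, after which all servers can return from vacation because
  \<open>c \<le> N\<close>. A service then lowers the inventory by one; refilling the hall,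
  recalling the servers and repeating empties the inventory.\<close>

lemma full_busy_empty_reachable:
  assumes T: "T \<subseteq> phases" "T \<noteq> {}"
    and closed: "\<And>x y. x \<in> T \<Longrightarrow> y \<in> phases \<Longrightarrow> x \<noteq> y \<Longrightarrow> 0 < H_within i x y \<Longrightarrow> y \<in> T"
  shows "mk_phase 0 c N \<in> T"
proof -
  have step: "y \<in> T" if "x \<in> T" "y \<in> phases" "x \<noteq> y" "a \<le> rate (i, x) (i, y)" "0 < a" for x y a
    using closed[OF that(1-3)] that(3-5) by (simp add: H_within_def)
  have arrival: "mk_phase i2 n (Suc i6) \<in> T" if "mk_phase i2 n i6 \<in> T" "n \<le> c" "i6 < N" for i2 n i6
  proof (rule step[OF that(1) _ _ rate_arrival pos(1)])
    have "mk_phase i2 n i6 \<in> phases" using that T(1) by blast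
    then show "mk_phase i2 n (Suc i6) \<in> phases" using that by (auto simp: mk_phase_in_phases)
  qed (use that in \<open>auto simp: mk_phase_eq_iff\<close>)
  have vacation: "mk_phase i2 (Suc n) i6 \<in> T"
    if "mk_phase i2 n i6 \<in> T" "n < c" "n + 1 \<le> max i2 i6" for i2 n i6
  proof (rule step[OF that(1) _ _ rate_vacation pos(5)])
    have "mk_phase i2 n i6 \<in> phases" using that T(1) by blast
    then show "mk_phase i2 (Suc n) i6 \<in> phases" using that by (simp add: mk_phase_in_phases)
  qed (use that in \<open>auto simp: mk_phase_eq_iff\<close>)
  have fill: "mk_phase i2 n N \<in> T" if "mk_phase i2 n i6 \<in> T" "n \<le> c" for i2 n i6
  proof -
    have "i6 \<le> N" using that T(1) mk_phase_in_phases by blast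
    then show ?thesis
    proof (induction rule: dec_induct)
      case (step j)
      then show ?case using arrival that(2) by simp
    qed fact
  qed
  have staff_up: "m \<le> c \<Longrightarrow> mk_phase i2 m N \<in> T" if "n \<le> m" "mk_phase i2 n N \<in> T" for i2 n m
    using that(1)
  proof (induction rule: dec_induct)
    case (step k)
    then show ?case using vacation[of i2 k N] c_le_N by simp
  qed (rule that(2))
  have staff: "mk_phase i2 c N \<in> T" if "mk_phase i2 n N \<in> T" "n \<le> c" for i2 n
    using staff_up that by blast
  have serve: "mk_phase i2 c N \<in> T" if "mk_phase (Suc i2) c N \<in> T" for i2
  proof -
    \<comment> \<open>A server may leave for vacation at this service; \<open>staff\<close> recalls
      it. If \<open>n' = 0\<close>, then \<open>c = 1\<close> and the remaining inventory is 0, so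
      the target is still a phase.\<close>
    define n' where "n' = (if c \<le> max (Suc i2 - 1) (N - 1) then c else c - 1)"
    have n': "n' \<le> c" by (simp add: n'_def)
    have busy: "1 \<le> min c (min (Suc i2) N)" using c_pos c_le_N by simp
    have "Suc i2 \<le> S" using that T(1) mk_phase_in_phases by blast
    have "mk_phase (Suc i2 - 1) n' (N - 1) \<in> T"
    proof (rule step[OF that _ _ rate_service[OF order_refl busy, folded n'_def] pos(3)])
      show "mk_phase (Suc i2 - 1) n' (N - 1) \<in> phases"
        unfolding mk_phase_in_phases[OF n'] using \<open>Suc i2 \<le> S\<close> c_pos c_le_N
        by (auto simp: n'_def)
      show "mk_phase (Suc i2) c N \<noteq> mk_phase (Suc i2 - 1) n' (N - 1)"
        using n' by (simp add: mk_phase_eq_iff)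
    qed
    then show ?thesis using staff[OF fill] n' by simp
  qed
  obtain x where "x \<in> T" using T(2) by blast
  then obtain i2 n i6 where "mk_phase i2 n i6 \<in> T" "n \<le> c" using T(1) phases_cases by blast
  then have "mk_phase i2 c N \<in> T" using staff[OF fill] by blast
  then show ?thesis by (induction i2) (auto intro: serve)
qed

section \<open>The queue as a level process, and the stability condition\<close>

lemma level_process_queue:
  assumes "1 \<le> M"
  shows "level_process phases H_up H_within H_down M (mk_phase 0 c N)"
proof
  show "mk_phase 0 c N \<in> phases" using c_pos c_le_N by (simp add: mk_phase_in_phases)
  \<comment> \<open>With the hall full, a customer joining the orbit leaves the phase
    unchanged.\<close>
  show "0 < H_up (mk_phase 0 c N) (mk_phase 0 c N)"
    unfolding H_up_def using rate_up[of c N 0 0 "mk_phase 0 c N"] pos by simp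
  show "mk_phase 0 c N \<in> T"
    if "T \<subseteq> phases" "T \<noteq> {}"
      "\<And>x y. x \<in> T \<Longrightarrow> y \<in> phases \<Longrightarrow> x \<noteq> y \<Longrightarrow> 0 < H_within i x y \<Longrightarrow> y \<in> T" for i T
    using that by (rule full_busy_empty_reachable)
  show "0 \<le> H_within i x y" if "x \<noteq> y" for i x y
    using that by (rule H_within_nonneg)
qed (simp_all only: H_up_def H_down_def rate_nonneg assms finite_phases
    H_row_sum[unfolded H_up_def H_down_def] H_row_sum_0[unfolded H_up_def])

end

theorem theorem3:
  fixes c N S s M :: nat
    and lam \<theta> \<mu> \<beta> \<eta> p :: real
    and \<phi> :: "phase \<Rightarrow> real"
    and E :: "phase set"
    and z1 z2 :: real
  assumes "1 \<le> c" and "c \<le> N" and "c \<le> s" and "s < S - s"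
    and "0 < lam" and "0 < \<theta>" and "0 < \<mu>" and "0 < \<beta>" and "0 < \<eta>"
    and "0 < p" and "p \<le> 1"
    and "1 \<le> M"
    and "E = queue_inventory.phases c N S s"
    and "stationary_prob_vector E
           (queue_inventory.phase_generator c N S s lam \<theta> \<mu> \<beta> \<eta> p M) \<phi>"
    and "z1 = (\<Sum>(i2, i3, i4, i5, i6) \<in> {(i2, i3, i4, i5, i6) \<in> E. i6 = N}.
                 \<phi> (i2, i3, i4, i5, i6))"
    and "z2 = (\<Sum>(i2, i3, i4, i5, i6) \<in> {(i2, i3, i4, i5, i6) \<in> E. i6 \<le> N - 1}.
                 \<phi> (i2, i3, i4, i5, i6))"
  shows "(\<exists>\<pi>. stationary_prob_vector (queue_inventory.states c N S s)
                (queue_inventory.truncated_generator c N S s lam \<theta> \<mu> \<beta> \<eta> p M) \<pi>)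
         \<longleftrightarrow> z1 * p * lam < z2 * real M * \<theta>"
proof -
  interpret queue_inventory_params c N S s lam \<theta> \<mu> \<beta> \<eta> p
    using assms by unfold_locales auto
  interpret L: level_process phases H_up H_within H_down M "mk_phase 0 c N"
    by (rule level_process_queue) fact
  have H: "L.H = phase_generator M"
    by (intro ext) (simp add: L.H_def phase_generator_def)
  have G: "L.G = truncated_generator M"
  proof (intro ext)
    show "L.G z w = truncated_generator M z w" for z w by (cases z; cases w) simp
  qed
  have S: "L.S = states" by (simp add: L.S_def states_def)
  \<comment> \<open>Makes \<open>i6 \<le> N - 1\<close> equivalent to \<open>i6 < N\<close> despite
    truncated subtraction.\<close>
  have N: "1 \<le> N" using c_pos c_le_N by simp
  have drift: "L.drift x = (if snd (snd (snd (snd x))) = N then p * lam else 0)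
      - (if snd (snd (snd (snd x))) \<le> N - 1 then real M * \<theta> else 0)" if "x \<in> phases" for x
    using sum_H_up[OF that, of "fst x" "fst (snd x)"] sum_H_down[OF that, of "fst x" "fst (snd x)"]
      assms(12) N unfolding L.drift_def by (cases x) (auto simp: less_eq_Suc_le)
  have z: "z1 = (\<Sum>x\<in>{x\<in>phases. snd (snd (snd (snd x))) = N}. \<phi> x)"
    "z2 = (\<Sum>x\<in>{x\<in>phases. snd (snd (snd (snd x))) \<le> N - 1}. \<phi> x)"
    using assms(13,15,16) by (auto intro!: sum.cong)
  have "(\<Sum>x\<in>phases. \<phi> x * L.drift x)
      = (\<Sum>x\<in>phases. (if snd (snd (snd (snd x))) = N then \<phi> x * (p * lam) else 0)
          - (if snd (snd (snd (snd x))) \<le> N - 1 then \<phi> x * (real M * \<theta>) else 0))"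
    using drift by (intro sum.cong) (auto simp: right_diff_distrib)
  also have "\<dots> = z1 * (p * lam) - z2 * (real M * \<theta>)"
    unfolding z sum_subtractf sum_distrib_right sum.inter_filter[OF finite_phases]
    by (intro arg_cong2[where f = "(-)"] sum.cong) auto
  finally show ?thesis
    using L.stationary_iff_drift_neg[of \<phi>] assms(13,14) by (simp add: H G S mult.assoc)
qed

end
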